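(* For every $\beta>1$ and every $t\in(0,1)$, $$\dim_H\big(\mathscr{E}_\beta\cap[t,1]\big)=\dim_H K_\beta(t).$$
   Context: For $\beta>1$ let $T_\beta:[0,1)\to[0,1)$, $T_\beta(x)=\beta x \bmod 1$. For $t\ge 0$ let $K_\beta(t)=\{x\in[0,1): T_\beta^n(x)\ge t\ \text{for all } n\ge 0\}$ (the survivor set). The bifurcation set is $$\mathscr{E}_\beta=\{t\in[0,1): K_\beta(t')\ne K_\beta(t)\ \text{for all } t'>t\}.$$ $\dim_H$ denotes Hausdorff dimension. *)

theory Defs
  imports "HOL-Analysis.Analysis"
begin

(* |U|^s with the usual conventions: 0 for the empty set, and 0^0 = 1 for singletons
   (powr alone gives 0 powr 0 = 0). Only meaningful for bounded U, since diameter is. *)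
definition hausdorff_gauge :: "real \<Rightarrow> 'a::metric_space set \<Rightarrow> ennreal" where
  "hausdorff_gauge s U =
     (if U = {} then 0 else if s = 0 then 1 else ennreal (diameter U powr s))"

definition delta_covers :: "real \<Rightarrow> 'a::metric_space set \<Rightarrow> (nat \<Rightarrow> 'a set) set" where
  "delta_covers \<delta> A =
     {U. A \<subseteq> (\<Union>i. U i) \<and> (\<forall>i. bounded (U i) \<and> diameter (U i) \<le> \<delta>)}"

definition hausdorff_premeasure :: "real \<Rightarrow> real \<Rightarrow> 'a::metric_space set \<Rightarrow> ennreal" where
  "hausdorff_premeasure s \<delta> A = (INF U\<in>delta_covers \<delta> A. \<Sum>i. hausdorff_gauge s (U i))"

definition hausdorff_measure :: "real \<Rightarrow> 'a::metric_space set \<Rightarrow> ennreal" where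
  "hausdorff_measure s A = (SUP \<delta>\<in>{0<..}. hausdorff_premeasure s \<delta> A)"

(* Infinite if no such s exists; the empty set has dimension 0. *)
definition hausdorff_dim :: "'a::metric_space set \<Rightarrow> ennreal" where
  "hausdorff_dim A = Inf {ennreal s |s. 0 \<le> s \<and> hausdorff_measure s A = 0}"

definition beta_map :: "real \<Rightarrow> real \<Rightarrow> real" where
  "beta_map \<beta> x = frac (\<beta> * x)"

definition survivor_set :: "real \<Rightarrow> real \<Rightarrow> real set" where
  "survivor_set \<beta> t = {x \<in> {0..<1}. \<forall>n. t \<le> (beta_map \<beta> ^^ n) x}"

definition bifurcation_set :: "real \<Rightarrow> real set" where
  "bifurcation_set \<beta> = {t \<in> {0..<1}. \<forall>t'>t. survivor_set \<beta> t' \<noteq> survivor_set \<beta> t}"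

end

theory Submission
  imports Defs "HOL-Library.List_Lexorder"
begin

text \<open>
  Write \<open>T\<close> for the map \<open>x \<mapsto> \<beta> x mod 1\<close> and \<open>K(c)\<close> for the survivor set of \<open>c\<close>. The iterates of \<open>T\<close> are
  continuous from the right, and this makes the bifurcation set the set of those \<open>y\<close> in \<open>[0, 1)\<close> that
  are the minimum of their own orbit (\<open>bifurcation_set_iff\<close>). So its part to the right of \<open>t\<close> lies in
  \<open>K(t)\<close>, and one inequality is monotonicity of the dimension.

  For the other inequality let \<open>K(t)\<close> have nonzero \<open>s\<close>-dimensional measure and let \<open>s' < s\<close>. The task is
  to find in the bifurcation set, to the right of \<open>t\<close>, a Cantor set with nonzero \<open>s'\<close>-dimensional
  measure. The finite words that are analogous to points minimal in their orbit are the Lyndon words: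
  such a word is smaller than every proper suffix of itself, and the comparison is decided within the
  suffix. Let \<open>l\<^sub>0\<close> be the smallest element of a set of Lyndon words of one length. Then every sequence
  \<open>l\<^sub>0 l\<^sub>1 l\<^sub>2 \<dots>\<close> of words of the set with \<open>l\<^sub>i > l\<^sub>0\<close> for \<open>i > 0\<close> is smaller than all its proper shifts. Hence a
  point with this itinerary is in the bifurcation set, and \<open>l\<^sub>1, l\<^sub>2, \<dots>\<close> can be chosen freely
  (\<open>cantor_set_in_bifurcation_set\<close>).

  This needs many Lyndon words, and their free concatenations must be itineraries of points.

  Lyndon words abound because every word is a nonincreasing product of Lyndon words. Put
  \<open>z = \<beta> powr (-s)\<close> and give a word \<open>w\<close> the weight \<open>z ^ length w\<close>. The words that are itineraries of
  points of a set of nonzero \<open>s\<close>-dimensional measure have infinite total weight. But this weight is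
  at most the product of \<open>1 / (1 - z ^ length l)\<close> over the Lyndon factors \<open>l\<close> that occur, so these Lyndon
  words have infinite total weight as well (\<open>null_if_lyndon_sums_bounded\<close>).

  To control concatenations, note that the points with first digits \<open>w\<close> are mapped by the iterate
  \<open>T ^^ length w\<close> onto an interval \<open>[0, r)\<close>, where the state \<open>r = range_end \<beta> 1 w\<close> is found by reading \<open>w\<close>.
  The states are \<open>1\<close> and its images under one map, so a state is determined by the number \<open>j\<close> of steps
  since the last visit to \<open>1\<close>, and so are the last \<open>j\<close> letters of the word. A Lyndon word with
  \<open>j \<ge> J\<close> is therefore determined by \<open>j\<close> and a prefix, and prefixes of Lyndon words are hardly more
  numerous than Lyndon words, being periodic prolongations of them. For large \<open>J\<close> the words with \<open>j \<ge> J\<close> have, up to a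
  constant, at most half of the weight (\<open>late_return_sum_le\<close>), and discarding them leaves a finite set of states.

  This finite set, together with \<open>t\<close> and \<open>1\<close>, contains neighbours \<open>c < e\<close> with \<open>K(c)\<close> of nonzero and
  \<open>K(e)\<close> of zero measure. Then some \<open>K(c) \<inter> [c, b)\<close> with \<open>b < e\<close> has nonzero measure
  (\<open>localise_between_states\<close>), and this is the set to which the count is applied. Since the factors are
  nonincreasing, not only the first one but all Lyndon factors begin at points below \<open>b\<close>. On the other hand,
  the state of a word of \<open>K(c)\<close> exceeds \<open>c\<close>, for the orbit goes on in \<open>[c, r)\<close>; so this state is at
  least \<open>e\<close>. Thus every long word of the family fits into the range that any other leaves, and all
  concatenations are itineraries.
\<close>

section \<open>Hausdorff null sets and dimension\<close>

lemma hausdorff_measure_eq_0_iff: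
  fixes A :: "'a::metric_space set"
  shows "hausdorff_measure s A = 0 \<longleftrightarrow>
    (\<forall>\<delta>>0. \<forall>\<epsilon>>0. \<exists>U\<in>delta_covers \<delta> A. (\<Sum>i. hausdorff_gauge s (U i)) < ennreal \<epsilon>)"
proof -
  have *: "x = 0 \<longleftrightarrow> (\<forall>\<epsilon>>0. x < ennreal \<epsilon>)" for x :: ennreal
  proof
    assume "\<forall>\<epsilon>>0. x < ennreal \<epsilon>"
    then have "x \<le> 0"
      using ennreal_le_epsilon[of 0 x] by (metis add_0 order_less_imp_le)
    then show "x = 0" by simp
  qed (simp add: ennreal_less_zero_iff)
  have "hausdorff_measure s A = 0 \<longleftrightarrow> (\<forall>\<delta>>0. hausdorff_premeasure s \<delta> A = 0)"
    unfolding hausdorff_measure_def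
    using SUP_bot_conv(1)[of "\<lambda>\<delta>. hausdorff_premeasure s \<delta> A" "{0<..}"] by (auto simp: bot_ennreal)
  also have "\<dots> \<longleftrightarrow> (\<forall>\<delta>>0. \<forall>\<epsilon>>0. hausdorff_premeasure s \<delta> A < ennreal \<epsilon>)"
    by (subst *) (rule refl)
  finally show ?thesis
    by (simp add: hausdorff_premeasure_def INF_less_iff)
qed

lemma hausdorff_null_subset:
  assumes "hausdorff_measure s B = 0" "A \<subseteq> B"
  shows "hausdorff_measure s A = 0"
proof -
  have "delta_covers \<delta> B \<subseteq> delta_covers \<delta> A" for \<delta>
    using assms(2) by (auto simp: delta_covers_def)
  then show ?thesis
    using assms(1) unfolding hausdorff_measure_eq_0_iff by blast
qed

lemma hausdorff_null_UN:
  fixes A :: "nat \<Rightarrow> 'a::metric_space set"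
  assumes "\<And>i. hausdorff_measure s (A i) = 0"
  shows "hausdorff_measure s (\<Union>i. A i) = 0"
  unfolding hausdorff_measure_eq_0_iff
proof (intro allI impI)
  fix \<delta> \<epsilon> :: real
  assume "\<delta> > 0" "\<epsilon> > 0"
  have "\<exists>U\<in>delta_covers \<delta> (A i). (\<Sum>j. hausdorff_gauge s (U j)) < ennreal (\<epsilon>/2 * (1/2)^Suc i)" for i
    using assms[of i, unfolded hausdorff_measure_eq_0_iff] \<open>\<delta> > 0\<close> \<open>\<epsilon> > 0\<close> by simp
  then obtain U where U: "\<And>i. U i \<in> delta_covers \<delta> (A i)"
      "\<And>i. (\<Sum>j. hausdorff_gauge s (U i j)) < ennreal (\<epsilon>/2 * (1/2)^Suc i)"
    by metis
  define V where "V = (\<lambda>n. case prod_decode n of (i, j) \<Rightarrow> U i j)"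
  have "V \<in> delta_covers \<delta> (\<Union>i. A i)"
  proof -
    have "x \<in> (\<Union>n. V n)" if x: "x \<in> A i" for x i
    proof -
      obtain j where "x \<in> U i j"
        using U(1)[of i] x unfolding delta_covers_def by blast
      then have "x \<in> V (prod_encode (i, j))" by (simp add: V_def)
      then show ?thesis by blast
    qed
    moreover have "bounded (V n) \<and> diameter (V n) \<le> \<delta>" for n
      using U(1) by (auto simp: V_def delta_covers_def split: prod.split)
    ultimately show ?thesis by (auto simp: delta_covers_def)
  qed
  moreover have "(\<Sum>n. hausdorff_gauge s (V n)) < ennreal \<epsilon>"
  proof -
    have "(\<Sum>n. hausdorff_gauge s (V n)) = (\<Sum>i. \<Sum>j. hausdorff_gauge s (U i j))"
      using suminf_ennreal_2dimen[where f="\<lambda>(i,j). hausdorff_gauge s (U i j)"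
          and g="\<lambda>i. \<Sum>j. hausdorff_gauge s (U i j)"]
      by (simp add: V_def split_def)
    also have "\<dots> \<le> (\<Sum>i. ennreal (\<epsilon>/2 * (1/2)^Suc i))"
      using U(2) by (intro suminf_le order_less_imp_le) auto
    also have "\<dots> = ennreal (\<Sum>i. \<epsilon>/2 * (1/2)^Suc i)"
      using \<open>\<epsilon> > 0\<close> sums_mult[OF power_half_series, of "\<epsilon>/2"]
      by (intro suminf_ennreal_eq[THEN trans]) (auto simp: sums_iff)
    also have "(\<Sum>i. \<epsilon>/2 * (1/2)^Suc i) = \<epsilon>/2"
      using sums_mult[OF power_half_series, of "\<epsilon>/2"] by (simp add: sums_iff)
    also have "ennreal (\<epsilon>/2) < ennreal \<epsilon>"
      using \<open>\<epsilon> > 0\<close> by (simp add: ennreal_less_iff)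
    finally show ?thesis .
  qed
  ultimately show "\<exists>V\<in>delta_covers \<delta> (\<Union>i. A i). (\<Sum>i. hausdorff_gauge s (V i)) < ennreal \<epsilon>"
    by blast
qed

lemma hausdorff_null_empty: "hausdorff_measure s {} = 0"
  unfolding hausdorff_measure_eq_0_iff
proof (intro allI impI)
  fix \<delta> \<epsilon> :: real
  assume "\<delta> > 0" "\<epsilon> > 0"
  then show "\<exists>U\<in>delta_covers \<delta> {}. (\<Sum>i. hausdorff_gauge s (U i)) < ennreal \<epsilon>"
    by (intro bexI[of _ "\<lambda>_. {}"]) (auto simp: hausdorff_gauge_def delta_covers_def)
qed

lemma hausdorff_null_UN_countable:
  assumes "countable I" "\<And>i. i \<in> I \<Longrightarrow> hausdorff_measure s (A i) = 0"
  shows "hausdorff_measure s (\<Union>i\<in>I. A i) = 0"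
proof (cases "I = {}")
  case True
  then show ?thesis by (simp add: hausdorff_null_empty)
next
  case False
  have "(\<Union>i\<in>I. A i) = (\<Union>n. A (from_nat_into I n))"
    by (subst range_from_nat_into[OF False assms(1), symmetric]) blast
  then show ?thesis
    using hausdorff_null_UN[of s "\<lambda>n. A (from_nat_into I n)"] assms(2) from_nat_into[OF False]
    by simp
qed

lemma hausdorff_gauge_le:
  assumes "0 < s" "0 \<le> diameter U" "diameter U \<le> d"
  shows "hausdorff_gauge s U \<le> ennreal (d powr s)"
  using assms powr_mono2[of s "diameter U" d] by (simp add: hausdorff_gauge_def ennreal_leI)

lemma diameter_le_dist:
  fixes S :: "'a::metric_space set"
  assumes "0 \<le> d" "\<And>x y. x \<in> S \<Longrightarrow> y \<in> S \<Longrightarrow> dist x y \<le> d"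
  shows "diameter S \<le> d"
  using assms by (auto simp: diameter_def intro!: cSUP_least)

lemma hausdorff_null_image_contraction:
  fixes f :: "'a::metric_space \<Rightarrow> 'b::metric_space"
  assumes "hausdorff_measure s A = 0" "0 < s"
    and "\<And>x y. dist (f x) (f y) \<le> dist x y"
  shows "hausdorff_measure s (f ` A) = 0"
  unfolding hausdorff_measure_eq_0_iff
proof (intro allI impI)
  fix \<delta> \<epsilon> :: real
  assume "\<delta> > 0" "\<epsilon> > 0"
  then obtain U where U: "U \<in> delta_covers \<delta> A" "(\<Sum>i. hausdorff_gauge s (U i)) < ennreal \<epsilon>"
    using assms(1) unfolding hausdorff_measure_eq_0_iff by blast
  have diam: "diameter (f ` U i) \<le> diameter (U i)" and bd: "bounded (f ` U i)" for i
  proof -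
    have b: "bounded (U i)" using U(1) by (auto simp: delta_covers_def)
    show "diameter (f ` U i) \<le> diameter (U i)"
      using diameter_bounded_bound[OF b] order_trans[OF assms(3)]
      by (intro diameter_le_dist diameter_ge_0[OF b]) blast
    show "bounded (f ` U i)"
      using b assms(3) unfolding bounded_def by (metis (no_types, lifting) imageE order_trans)
  qed
  have cover: "A \<subseteq> (\<Union>i. U i)" and le: "\<And>i. diameter (U i) \<le> \<delta>"
    using U(1) by (auto simp: delta_covers_def)
  have "f ` A \<subseteq> (\<Union>i. f ` U i)"
    using cover by blast
  then have V: "(\<lambda>i. f ` U i) \<in> delta_covers \<delta> (f ` A)"
    using bd order_trans[OF diam le] by (simp add: delta_covers_def)
  have "hausdorff_gauge s (f ` U i) \<le> hausdorff_gauge s (U i)" for i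
    using hausdorff_gauge_le[OF assms(2) diameter_ge_0[OF bd] diam, of i] assms(2)
    by (cases "U i = {}") (simp_all add: hausdorff_gauge_def)
  then have "(\<Sum>i. hausdorff_gauge s (f ` U i)) \<le> (\<Sum>i. hausdorff_gauge s (U i))"
    by (rule suminf_le) simp_all
  then have "(\<Sum>i. hausdorff_gauge s (f ` U i)) < ennreal \<epsilon>"
    using U(2) by simp
  then show "\<exists>V\<in>delta_covers \<delta> (f ` A). (\<Sum>i. hausdorff_gauge s (V i)) < ennreal \<epsilon>"
    by (rule bexI[OF _ V])
qed

text \<open>The \<open>n\<close>-th cover bounds the premeasure at scale \<open>r n\<close> by \<open>card (C n) * r n powr s\<close>.\<close>

lemma hausdorff_null_finite_covers:
  fixes A :: "'a::metric_space set" and C :: "nat \<Rightarrow> 'b set"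
  assumes "0 < s" "r \<longlonglongrightarrow> 0" "(\<lambda>n. real (card (C n)) * r n powr s) \<longlonglongrightarrow> 0"
    and "\<And>n. finite (C n)" "\<And>n. A \<subseteq> (\<Union>w\<in>C n. V n w)"
    and "\<And>n w x y. x \<in> V n w \<Longrightarrow> y \<in> V n w \<Longrightarrow> dist x y \<le> r n" "\<And>n. 0 \<le> r n"
  shows "hausdorff_measure s A = 0"
  unfolding hausdorff_measure_eq_0_iff
proof (intro allI impI)
  fix \<delta> \<epsilon> :: real
  assume "\<delta> > 0" "\<epsilon> > 0"
  then have "eventually (\<lambda>n. r n < \<delta> \<and> real (card (C n)) * r n powr s < \<epsilon>) sequentially"
    by (intro eventually_conj order_tendstoD(2)[OF assms(2)] order_tendstoD(2)[OF assms(3)])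
  then obtain n where n: "r n < \<delta>" "real (card (C n)) * r n powr s < \<epsilon>"
    by (auto simp: eventually_sequentially)
  obtain g where g: "bij_betw g {..<card (C n)} (C n)"
    using assms(4) bij_betw_from_nat_into_finite by blast
  define U where "U = (\<lambda>i. if i < card (C n) then V n (g i) else {})"
  have bd: "bounded (V n w)" and diam: "diameter (V n w) \<le> r n" for w
  proof -
    show "bounded (V n w)"
      using assms(6) unfolding bounded_def by (metis (full_types))
    show "diameter (V n w) \<le> r n"
      using assms(6,7) by (intro diameter_le_dist) auto
  qed
  have "U \<in> delta_covers \<delta> A"
  proof -
    have "x \<in> (\<Union>i. U i)" if "x \<in> A" for x
    proof -
      obtain w where "w \<in> C n" "x \<in> V n w" using assms(5)[of n] \<open>x \<in> A\<close> by blast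
      moreover obtain i where "i < card (C n)" "g i = w"
        using g \<open>w \<in> C n\<close> by (metis bij_betw_def imageE lessThan_iff)
      ultimately have "x \<in> U i" by (simp add: U_def)
      then show ?thesis by blast
    qed
    moreover have "bounded (U i) \<and> diameter (U i) \<le> \<delta>" for i
      using bd diam[of "g i"] n(1) \<open>\<delta> > 0\<close> by (auto simp: U_def)
    ultimately show ?thesis by (auto simp: delta_covers_def)
  qed
  moreover have "(\<Sum>i. hausdorff_gauge s (U i)) < ennreal \<epsilon>"
  proof -
    have "(\<Sum>i. hausdorff_gauge s (U i)) = (\<Sum>i<card (C n). hausdorff_gauge s (U i))"
      by (rule suminf_finite) (auto simp: U_def hausdorff_gauge_def)
    also have "\<dots> \<le> (\<Sum>i<card (C n). ennreal (r n powr s))"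
      using hausdorff_gauge_le[OF assms(1) diameter_ge_0[OF bd] diam]
      by (intro sum_mono) (simp add: U_def)
    also have "\<dots> = ennreal (real (card (C n)) * r n powr s)"
      by (simp add: ennreal_mult ennreal_of_nat_eq_real_of_nat)
    also have "\<dots> < ennreal \<epsilon>"
      using n(2) \<open>\<epsilon> > 0\<close> by (simp add: ennreal_less_iff)
    finally show ?thesis .
  qed
  ultimately show "\<exists>U\<in>delta_covers \<delta> A. (\<Sum>i. hausdorff_gauge s (U i)) < ennreal \<epsilon>"
    by blast
qed

lemma hausdorff_null_exponent_mono:
  assumes "hausdorff_measure s A = 0" "0 \<le> s" "s \<le> s'"
  shows "hausdorff_measure s' A = 0"
  unfolding hausdorff_measure_eq_0_iff
proof (intro allI impI)
  fix \<delta> \<epsilon> :: real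
  assume "\<delta> > 0" "\<epsilon> > 0"
  then have "min \<delta> 1 > 0" by simp
  then obtain U where U: "U \<in> delta_covers (min \<delta> 1) A" "(\<Sum>i. hausdorff_gauge s (U i)) < ennreal \<epsilon>"
    using assms(1) \<open>\<epsilon> > 0\<close> unfolding hausdorff_measure_eq_0_iff by blast
  have "hausdorff_gauge s' (U i) \<le> hausdorff_gauge s (U i)" for i
  proof -
    have "bounded (U i)" "diameter (U i) \<le> 1" using U(1) by (auto simp: delta_covers_def)
    then have "diameter (U i) powr s' \<le> diameter (U i) powr s" "diameter (U i) powr s' \<le> 1"
      using assms(2,3) diameter_ge_0[of "U i"] by (auto intro: powr_mono' powr_le1)
    then show ?thesis
      using assms(2,3) ennreal_leI[of "diameter (U i) powr s'" 1]
      by (auto simp: hausdorff_gauge_def intro!: ennreal_leI)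
  qed
  then have "(\<Sum>i. hausdorff_gauge s' (U i)) \<le> (\<Sum>i. hausdorff_gauge s (U i))"
    by (rule suminf_le) simp_all
  then have "(\<Sum>i. hausdorff_gauge s' (U i)) < ennreal \<epsilon>"
    using U(2) by simp
  moreover have "U \<in> delta_covers \<delta> A"
    using U(1) by (auto simp: delta_covers_def)
  ultimately show "\<exists>U\<in>delta_covers \<delta> A. (\<Sum>i. hausdorff_gauge s' (U i)) < ennreal \<epsilon>"
    by blast
qed

lemma hausdorff_dim_mono: "A \<subseteq> B \<Longrightarrow> hausdorff_dim A \<le> hausdorff_dim B"
  unfolding hausdorff_dim_def using hausdorff_null_subset[of _ B A]
  by (intro Inf_superset_mono) auto

lemma not_null_below_hausdorff_dim:
  assumes "0 \<le> s" "ennreal s < hausdorff_dim A"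
  shows "hausdorff_measure s A \<noteq> 0"
  using assms unfolding hausdorff_dim_def by (metis (mono_tags, lifting) Inf_lower leD mem_Collect_eq)

lemma hausdorff_dim_ge:
  assumes "hausdorff_measure s A \<noteq> 0" "0 \<le> s"
  shows "ennreal s \<le> hausdorff_dim A"
  unfolding hausdorff_dim_def
proof (rule Inf_greatest, clarify)
  fix s' :: real assume "0 \<le> s'" "hausdorff_measure s' A = 0"
  then show "ennreal s \<le> ennreal s'"
    using hausdorff_null_exponent_mono[of s' A s] assms by (intro ennreal_leI) linarith
qed

text \<open>A substitute for the mass distribution principle. The inverse of \<open>h\<close> is Hoelder continuous, so a cover
  of \<open>A\<close> pulls back to a cover of the unit interval whose Lebesgue measure is bounded by the gauges.\<close>

lemma not_null_if_expanding:
  fixes h :: "real \<Rightarrow> 'a::metric_space"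
  assumes "0 < s" "0 < C" "h ` {0..<1} \<subseteq> A"
    and expand: "\<And>u v. u \<in> {0..<1} \<Longrightarrow> v \<in> {0..<1} \<Longrightarrow> \<bar>u - v\<bar> \<le> C * dist (h u) (h v) powr s"
  shows "hausdorff_measure s A \<noteq> 0"
proof
  assume "hausdorff_measure s A = 0"
  then obtain U where U: "U \<in> delta_covers 1 A" "(\<Sum>i. hausdorff_gauge s (U i)) < ennreal (1 / (4*C))"
    using \<open>0 < C\<close> unfolding hausdorff_measure_eq_0_iff by (metis zero_less_one zero_less_divide_1_iff mult_pos_pos zero_less_numeral)
  define X where "X = (\<lambda>i. {u\<in>{0..<1}. h u \<in> U i})"
  have "\<exists>Y\<in>sets lborel. X i \<subseteq> Y \<and> emeasure lborel Y \<le> ennreal (2*C) * hausdorff_gauge s (U i)" for i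
  proof (cases "X i = {}")
    case True
    then show ?thesis by (intro bexI[of _ "{}"]) auto
  next
    case False
    then obtain u where u: "u \<in> X i" by blast
    define D where "D = C * diameter (U i) powr s"
    have b: "bounded (U i)" using U(1) by (auto simp: delta_covers_def)
    have "X i \<subseteq> {u - D..u + D}"
    proof
      fix v assume v: "v \<in> X i"
      have "\<bar>u - v\<bar> \<le> C * dist (h u) (h v) powr s"
        using u v by (intro expand) (auto simp: X_def)
      also have "\<dots> \<le> D"
        unfolding D_def using u v b assms(1,2)
        by (intro mult_left_mono powr_mono2 diameter_bounded_bound) (auto simp: X_def)
      finally show "v \<in> {u - D..u + D}" by auto
    qed
    moreover have "emeasure lborel {u - D..u + D} \<le> ennreal (2*C) * hausdorff_gauge s (U i)"
    proof -
      have "D \<ge> 0" using assms(2) by (simp add: D_def)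
      then have "emeasure lborel {u - D..u + D} = ennreal (2 * D)" by simp
      also have "\<dots> = ennreal (2*C) * ennreal (diameter (U i) powr s)"
        using assms(2) by (simp add: D_def ennreal_mult[symmetric])
      also have "\<dots> = ennreal (2*C) * hausdorff_gauge s (U i)"
        using u assms(1) by (auto simp: hausdorff_gauge_def X_def)
      finally show ?thesis by simp
    qed
    ultimately show ?thesis by (intro bexI[of _ "{u - D..u + D}"]) auto
  qed
  then obtain Y where Y: "\<And>i. Y i \<in> sets lborel" "\<And>i. X i \<subseteq> Y i"
     "\<And>i. emeasure lborel (Y i) \<le> ennreal (2*C) * hausdorff_gauge s (U i)" by metis
  have "{0..<1} \<subseteq> (\<Union>i. Y i)"
  proof
    fix u :: real assume u: "u \<in> {0..<1}"
    then have "h u \<in> (\<Union>i. U i)"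
      using U(1) assms(3) unfolding delta_covers_def by blast
    then obtain i where "h u \<in> U i" by blast
    with u show "u \<in> (\<Union>i. Y i)" using Y(2)[of i] by (auto simp: X_def)
  qed
  then have "emeasure lborel {0..<1::real} \<le> emeasure lborel (\<Union>i. Y i)"
    using Y(1) by (intro emeasure_mono) auto
  also have "\<dots> \<le> (\<Sum>i. emeasure lborel (Y i))"
    using Y(1) by (intro emeasure_subadditive_countably) auto
  also have "\<dots> \<le> (\<Sum>i. ennreal (2*C) * hausdorff_gauge s (U i))"
    using Y(3) by (intro suminf_le) auto
  also have "\<dots> = ennreal (2*C) * (\<Sum>i. hausdorff_gauge s (U i))" by simp
  also have "\<dots> \<le> ennreal (2*C) * ennreal (1 / (4*C))"
    using U(2) by (intro mult_left_mono) auto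
  also have "\<dots> = ennreal (1/2)"
    using assms(2) by (simp add: ennreal_mult[symmetric])
  finally have "emeasure lborel {0..<1::real} \<le> ennreal (1/2)" .
  moreover have "emeasure lborel {0..<1::real} = ennreal 1" by simp
  ultimately have "ennreal 1 \<le> ennreal (1/2)" by (simp only:)
  then show False by (subst (asm) ennreal_le_iff) simp_all
qed

section \<open>Lyndon words\<close>

lemma append_less_append_if_less:
  fixes xs ys :: "'a::linorder list"
  assumes "length xs = length ys" "xs < ys"
  shows "xs @ us < ys @ vs"
  using assms
proof (induction xs ys rule: list_induct2)
  case (Cons x xs y ys)
  then show ?case by (auto simp: Cons_less_Cons)
qed simp

lemma append_less_append_same:
  fixes us vs :: "'a::linorder list"
  shows "xs @ us < xs @ vs \<longleftrightarrow> us < vs"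
  by (induction xs) (auto simp: Cons_less_Cons)

lemma append_le_append_same:
  fixes us vs :: "'a::linorder list"
  shows "xs @ us \<le> xs @ vs \<longleftrightarrow> us \<le> vs"
  by (simp add: append_less_append_same flip: not_less)

lemma le_append: "(xs :: 'a::linorder list) \<le> xs @ ys"
  using append_le_append_same[of xs "[]" ys] by simp

lemma take_mono_lex:
  fixes xs ys :: "'a::linorder list"
  assumes "xs \<le> ys" "m \<le> length xs" "m \<le> length ys"
  shows "take m xs \<le> take m ys"
proof (rule ccontr)
  assume "\<not> take m xs \<le> take m ys"
  then have "take m ys @ drop m ys < take m xs @ drop m xs"
    using assms(2,3) by (intro append_less_append_if_less) auto
  then show False using assms(1) by simp
qed

text \<open>In the lexicographic order a prefix precedes its extensions; so a strict inequality with a word that is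
  not longer is decided within the length of that word.\<close>

lemma take_less_if_less:
  fixes xs ys :: "'a::linorder list"
  assumes "xs < ys" "length ys \<le> length xs"
  shows "take (length ys) xs < ys"
proof -
  have "take (length ys) xs \<le> ys"
    using take_mono_lex[of xs ys "length ys"] assms by simp
  moreover have "take (length ys) xs \<noteq> ys"
    using assms(1) le_append[of ys "drop (length ys) xs"] by (metis append_take_drop_id leD)
  ultimately show ?thesis by simp
qed

text \<open>The usual definition compares the word itself with its proper suffixes. Comparing a prefix of the same
  length instead expresses that the comparison is decided within the suffix, and so is not affected by the
  letters that follow.\<close>

definition lyndon :: "'a::linorder list \<Rightarrow> bool" where
  "lyndon l \<longleftrightarrow> l \<noteq> [] \<and> (\<forall>j. 0 < j \<longrightarrow> j < length l \<longrightarrow> take (length l - j) l < drop j l)"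

text \<open>The least nonempty suffix is Lyndon because its own suffixes compete with it.\<close>

lemma lyndon_minimal_suffix:
  fixes w :: "'a::linorder list"
  assumes "w \<noteq> []"
  shows "\<exists>u l. w = u @ l \<and> lyndon l \<and> (\<forall>u' v. w = u' @ v \<longrightarrow> v \<noteq> [] \<longrightarrow> l \<le> v)"
proof -
  define S where "S = (\<lambda>i. drop i w) ` {..<length w}"
  have S: "finite S" "S \<noteq> {}" using assms by (auto simp: S_def)
  have "Min S \<in> S" using S by (rule Min_in)
  then obtain i where i: "i < length w" "Min S = drop i w"
    unfolding S_def by blast
  define l where "l = drop i w"
  have min: "l \<le> v" if "w = u' @ v" "v \<noteq> []" for u' v
  proof -
    have "v = drop (length u') w" "length u' < length w" using that by auto
    then have "v \<in> S" by (auto simp: S_def)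
    then show ?thesis using S i by (simp add: l_def Min_le[of S v, unfolded i])
  qed
  have "take (length l - j) l < drop j l" if j: "0 < j" "j < length l" for j
  proof -
    have "w = (take i w @ take j l) @ drop j l"
      using append_take_drop_id[of j l] append_take_drop_id[of i w] by (simp add: l_def)
    from min[OF this] have "l \<le> drop j l" using j by simp
    moreover have "l \<noteq> drop j l" using j by (metis diff_less length_drop less_irrefl order_less_trans)
    ultimately show ?thesis
      using take_less_if_less[of l "drop j l"] by simp
  qed
  then have "lyndon l" using i by (simp add: lyndon_def l_def)
  moreover have "w = take i w @ l" by (simp add: l_def)
  ultimately show ?thesis using min by blast
qed

text \<open>Existence in the theorem of Chen, Fox and Lyndon: split off the least suffix again and again. The last
  conjunct carries the induction, since it shows that the next factor split off is not smaller than the one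
  before.\<close>

lemma lyndon_factorisation:
  fixes w :: "'a::linorder list"
  shows "\<exists>ls. w = concat ls \<and> (\<forall>l\<in>set ls. lyndon l) \<and> sorted_wrt (\<ge>) ls \<and>
    (\<forall>u v. w = u @ v \<longrightarrow> v \<noteq> [] \<longrightarrow> last ls \<le> v)"
proof (induction "length w" arbitrary: w rule: less_induct)
  case less
  show ?case
  proof (cases "w = []")
    case True
    then show ?thesis by (intro exI[of _ "[]"]) simp
  next
    case False
    obtain u l where w: "w = u @ l" and l: "lyndon l"
      and min: "\<And>u' v. w = u' @ v \<Longrightarrow> v \<noteq> [] \<Longrightarrow> l \<le> v"
      using lyndon_minimal_suffix[OF False] by blast
    have "l \<noteq> []" using l by (simp add: lyndon_def)
    then have "length u < length w" by (simp add: w)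
    from less[OF this] obtain ls where ls: "u = concat ls" "\<forall>l\<in>set ls. lyndon l" "sorted_wrt (\<ge>) ls"
      by blast
    have "l \<le> l'" if l': "l' \<in> set ls" for l'
    proof -
      have "l \<le> last ls"
      proof (rule ccontr)
        assume less: "\<not> l \<le> last ls"
        have "ls \<noteq> []" using l' by auto
        define k where "k = last ls"
        have k: "k < l" "k \<noteq> []" "u = concat (butlast ls) @ k"
        proof -
          have "lyndon k" using ls(2) \<open>ls \<noteq> []\<close> by (simp add: k_def)
          then show "k < l" "k \<noteq> []" using less by (auto simp: k_def lyndon_def)
          have "concat (butlast ls @ [k]) = concat (butlast ls) @ k" by simp
          then show "u = concat (butlast ls) @ k"
            using ls(1) \<open>ls \<noteq> []\<close> by (simp add: k_def)
        qed
        \<comment> \<open>The suffix \<open>k @ l\<close> of \<open>w\<close> would be smaller than the least suffix \<open>l\<close>, unless \<open>k\<close> is a prefix of \<open>l\<close>; but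
          then the rest of \<open>l\<close> is a shorter suffix that is not larger.\<close>
        have le: "l \<le> k @ l" using min[of "concat (butlast ls)" "k @ l"] k w by simp
        show False
        proof (cases "\<exists>m. l = k @ m")
          case True
          then obtain m where m: "l = k @ m" by blast
          then have "m \<noteq> []" using k(1) by auto
          then have "l \<le> m" using min[of "u @ k" m] w m by simp
          moreover have "m \<le> l" using le m by (simp add: append_le_append_same)
          ultimately have "m = l" by simp
          then show False using m k(2) by simp
        next
          case False
          have "k @ l < l"
          proof (cases "length k \<le> length l")
            case True
            have "k \<noteq> take (length k) l" using False by (metis append_take_drop_id)
            moreover have "k \<le> take (length k) l"
              using take_mono_lex[of k l "length k"] k(1) True by simp
            ultimately have "k @ l < take (length k) l @ drop (length k) l"
              using True by (intro append_less_append_if_less) auto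
            then show ?thesis by simp
          next
            case False
            then have "take (length l) k < l" using take_less_if_less[OF k(1)] by simp
            then have "take (length l) k @ (drop (length l) k @ l) < l @ []"
              using False by (intro append_less_append_if_less) auto
            then show ?thesis by (metis append_Nil2 append_assoc append_take_drop_id)
          qed
          then show False using le by simp
        qed
      qed
      moreover have "last ls \<le> l'"
      proof -
        obtain as bs where ab: "ls = as @ l' # bs" using l' by (meson split_list)
        then show ?thesis using ls(3) by (cases "bs = []") (auto simp: sorted_wrt_append)
      qed
      ultimately show ?thesis by simp
    qed
    then have "sorted_wrt (\<ge>) (ls @ [l])" using ls by (simp add: sorted_wrt_append)
    then show ?thesis using w l ls min by (intro exI[of _ "ls @ [l]"]) auto
  qed
qed

text \<open>Prefixes of Lyndon words satisfy the hypothesis. The conclusion says that such a word is determined by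
  its length and a Lyndon prefix. The induction appends a letter \<open>d\<close>. Comparison with the prefix excludes
  that \<open>d\<close> is smaller than the letter \<open>c\<close> that would continue the period; if \<open>d = c\<close> the period
  persists, and if \<open>d > c\<close> the whole word is Lyndon.\<close>

lemma lyndon_prefix_periodic:
  fixes g :: "'a::linorder list"
  assumes "g \<noteq> []" "\<And>j. j < length g \<Longrightarrow> take (length g - j) g \<le> drop j g"
  shows "\<exists>m. 0 < m \<and> m \<le> length g \<and> lyndon (take m g) \<and> (\<forall>i. i + m < length g \<longrightarrow> g ! (i + m) = g ! i)"
  using assms
proof (induction g rule: rev_induct)
  case (snoc d g)
  show ?case
  proof (cases "g = []")
    case True
    then show ?thesis by (intro exI[of _ 1]) (simp add: lyndon_def)
  next
    case False
    have pn: "take (length g - j) g \<le> drop j g" if "j < length g" for j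
    proof -
      have "take (length (g@[d]) - j) (g@[d]) \<le> drop j (g@[d])" using that by (intro snoc.prems) auto
      then have "take (length g - j) (take (Suc (length g) - j) g @ take (1 - j) [d])
          \<le> take (length g - j) (drop j g @ [d])"
        using that by (intro take_mono_lex) auto
      then show ?thesis using that by simp
    qed
    from snoc.IH[OF False this] obtain m where m: "0 < m" "m \<le> length g" "lyndon (take m g)"
      and per: "\<And>i. i + m < length g \<Longrightarrow> g ! (i + m) = g ! i" by blast
    define k where "k = length g"
    define c where "c = g ! (k - m)"
    have dropm: "drop m g = take (k - m) g"
      using m per by (intro nth_equalityI) (auto simp: k_def add.commute)
    have take_Suc: "take (Suc (k - j)) g = take (k - j) g @ [g ! (k - j)]" if "0 < j" "j \<le> k" for j
      using that by (intro take_Suc_conv_app_nth) (auto simp: k_def)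
    have "take (Suc (k - m)) g \<le> drop m g @ [d]"
      using snoc.prems(2)[of m] m by (simp add: k_def Suc_diff_le)
    then have "c \<le> d"
      using m take_Suc[of m] by (auto simp: dropm append_le_append_same c_def k_def)
    show ?thesis
    proof (cases "c = d")
      case True
      have "(g @ [d]) ! (i + m) = (g @ [d]) ! i" if "i + m < length (g @ [d])" for i
      proof (cases "i + m < k")
        case True
        then show ?thesis using per[of i] by (simp add: nth_append k_def)
      next
        case False
        then have "i = k - m" using that m by (simp add: k_def)
        then show ?thesis using \<open>c = d\<close> m by (simp add: nth_append c_def k_def)
      qed
      then show ?thesis using m by (intro exI[of _ m]) simp
    next
      case False
      then have "c < d" using \<open>c \<le> d\<close> by simp
      have "take (Suc k - j) (g @ [d]) < drop j (g @ [d])" if j: "0 < j" "j < Suc k" for j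
      proof -
        have eq: "take (Suc k - j) (g @ [d]) = take (k - j) g @ [g ! (k - j)]"
          using j take_Suc[of j] by (simp add: k_def Suc_diff_le)
        have eq': "drop j (g @ [d]) = drop j g @ [d]" using j by (simp add: k_def)
        have "take (k - j) g \<le> drop j g" using pn[of j] j by (cases "j = k") (auto simp: k_def)
        then consider "take (k - j) g < drop j g" | (border) "drop j g = take (k - j) g" by fastforce
        then show ?thesis
        proof cases
          case 1
          then show ?thesis unfolding eq eq' by (rule append_less_append_if_less[rotated]) (use j in \<open>simp add: k_def\<close>)
        next
          case border
          \<comment> \<open>Otherwise the border of \<open>g\<close> would give the Lyndon word \<open>take m g\<close> a proper border.\<close>
          have "m \<le> j"
          proof (rule ccontr)
            assume "\<not> m \<le> j"
            then have "drop j (take m g) = take (m - j) (take (k - j) g)"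
              using border by (simp add: drop_take)
            also have "\<dots> = take (m - j) (take m g)"
              using m j by (simp add: min_def k_def)
            finally have "drop j (take m g) = take (m - j) (take m g)" .
            moreover have "length (take m g) = m" using m by simp
            ultimately show False
              using m(3) \<open>\<not> m \<le> j\<close> j unfolding lyndon_def by (metis less_irrefl not_le)
          qed
          have "take (length g - (j - m)) g \<le> drop (j - m) g"
            using m j \<open>m \<le> j\<close> by (intro pn) (simp add: k_def)
          then have "take (Suc (k - j)) (take (length g - (j - m)) g)
              \<le> take (Suc (k - j)) (drop (j - m) g)"
            using m j \<open>m \<le> j\<close> by (intro take_mono_lex) (auto simp: k_def)
          moreover have "Suc (k - j) \<le> length g - (j - m)"
            using m j \<open>m \<le> j\<close> by (simp add: k_def)
          ultimately have "take (Suc (k - j)) g \<le> take (Suc (k - j)) (drop (j - m) g)"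
            by (simp add: min_absorb1)
          moreover have "take (Suc (k - j)) (drop (j - m) g) = take (k - j) g @ [c]"
          proof (rule nth_equalityI)
            fix i assume "i < length (take (Suc (k - j)) (drop (j - m) g))"
            then have i: "i \<le> k - j" using j m \<open>m \<le> j\<close> by simp
            show "take (Suc (k - j)) (drop (j - m) g) ! i = (take (k - j) g @ [c]) ! i"
            proof (cases "i = k - j")
              case True
              then show ?thesis using j m \<open>m \<le> j\<close> by (simp add: nth_append c_def k_def)
            next
              case False
              then have "i < k - j" using i by simp
              have "g ! (j - m + i) = g ! (j + i)"
                using per[of "j - m + i"] \<open>i < k - j\<close> \<open>m \<le> j\<close> by (simp add: k_def)
              also have "\<dots> = drop j g ! i" using j by (simp add: k_def)
              also have "\<dots> = g ! i" using border \<open>i < k - j\<close> by simp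
              finally show ?thesis using \<open>i < k - j\<close> j m \<open>m \<le> j\<close> by (simp add: nth_append k_def)
            qed
          qed (use j m \<open>m \<le> j\<close> in \<open>auto simp: k_def min_def\<close>)
          ultimately have "g ! (k - j) \<le> c"
            using j take_Suc[of j] by (auto simp: append_le_append_same)
          then show ?thesis
            unfolding eq eq' border using \<open>c < d\<close> by (simp add: append_less_append_same)
        qed
      qed
      then have "lyndon (g @ [d])" by (simp add: lyndon_def k_def)
      then show ?thesis by (intro exI[of _ "Suc k"]) (simp add: k_def)
    qed
  qed
qed simp

section \<open>Digits, inverse branches and states\<close>

definition digit :: "real \<Rightarrow> real \<Rightarrow> nat" where
  "digit \<beta> x = nat \<lfloor>\<beta> * x\<rfloor>"

fun itinerary :: "real \<Rightarrow> nat \<Rightarrow> real \<Rightarrow> nat list" where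
  "itinerary \<beta> 0 x = []"
| "itinerary \<beta> (Suc n) x = digit \<beta> x # itinerary \<beta> n (beta_map \<beta> x)"

fun branch :: "real \<Rightarrow> nat list \<Rightarrow> real \<Rightarrow> real" where
  "branch \<beta> [] y = y"
| "branch \<beta> (d # w) y = (real d + branch \<beta> w y) / \<beta>"

text \<open>For \<open>0 \<le> y\<close> this says that \<open>branch \<beta> w y\<close> has first digits \<open>w\<close> and reaches \<open>y\<close> after \<open>length w\<close> steps.\<close>

definition branch_valid :: "real \<Rightarrow> nat list \<Rightarrow> real \<Rightarrow> bool" where
  "branch_valid \<beta> w y \<longleftrightarrow> (\<forall>j\<le>length w. branch \<beta> (drop j w) y < 1)"

fun range_end :: "real \<Rightarrow> real \<Rightarrow> nat list \<Rightarrow> real" where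
  "range_end \<beta> r [] = r"
| "range_end \<beta> r (d # w) = range_end \<beta> (min 1 (\<beta> * r - real d)) w"

text \<open>\<open>range_end \<beta> r w\<close> is the end of the interval onto which the points of \<open>[0, r)\<close> with first digits \<open>w\<close>
  are mapped by the iterate of length \<open>length w\<close>; it is not positive if there are no such points. \<open>last_state\<close>
  is the transition under the largest digit that can occur at a state; all smaller digits lead to the state \<open>1\<close>.
  From \<open>1\<close> this map generates the expansion of \<open>1\<close> whose remainders are positive, and \<open>last_digits\<close> lists the
  digits of that expansion.\<close>

definition last_state :: "real \<Rightarrow> real \<Rightarrow> real" where
  "last_state \<beta> r = \<beta> * r - (of_int \<lceil>\<beta> * r\<rceil> - 1)"

definition last_digits :: "real \<Rightarrow> nat \<Rightarrow> nat list" where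
  "last_digits \<beta> j = map (\<lambda>i. nat (\<lceil>\<beta> * (last_state \<beta> ^^ i) 1\<rceil> - 1)) [0..<j]"

text \<open>The states fewer than \<open>J\<close> steps after a visit to the state \<open>1\<close>.\<close>

definition early_states :: "real \<Rightarrow> nat \<Rightarrow> real set" where
  "early_states \<beta> J = (\<lambda>j. (last_state \<beta> ^^ j) 1) ` {..<J}"

lemma beta_map_bounds: "0 \<le> beta_map \<beta> x" "beta_map \<beta> x < 1"
  by (simp_all add: beta_map_def frac_ge_0 frac_lt_1)

lemma beta_map_funpow_bounds:
  assumes "x \<in> {0..<1}"
  shows "(beta_map \<beta> ^^ n) x \<in> {0..<1}"
  using assms beta_map_bounds by (cases n) auto

lemma length_itinerary [simp]: "length (itinerary \<beta> n x) = n"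
  by (induction n arbitrary: x) auto

lemma itinerary_add:
  "itinerary \<beta> (m + n) x = itinerary \<beta> m x @ itinerary \<beta> n ((beta_map \<beta> ^^ m) x)"
  by (induction m arbitrary: x) (auto simp: funpow_swap1)

lemma branch_append: "branch \<beta> (u @ v) y = branch \<beta> u (branch \<beta> v y)"
  by (induction u) auto

lemma range_end_append: "range_end \<beta> r (u @ v) = range_end \<beta> (range_end \<beta> r u) v"
  by (induction u arbitrary: r) auto

context
  fixes \<beta> :: real
  assumes beta: "1 < \<beta>"
begin

lemma digit_beta_map: "0 \<le> x \<Longrightarrow> \<beta> * x = real (digit \<beta> x) + beta_map \<beta> x"
  using beta by (simp add: digit_def beta_map_def frac_def)

lemma beta_map_inverse_branch:
  assumes "0 \<le> y" "y < 1"
  shows "beta_map \<beta> ((real d + y) / \<beta>) = y" "digit \<beta> ((real d + y) / \<beta>) = d"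
proof -
  have *: "\<beta> * ((real d + y) / \<beta>) = real d + y" using beta by simp
  have "\<lfloor>real d + y\<rfloor> = int d" using assms by linarith
  then show "beta_map \<beta> ((real d + y) / \<beta>) = y" "digit \<beta> ((real d + y) / \<beta>) = d"
    unfolding beta_map_def digit_def * frac_def by simp_all
qed

lemma branch_affine: "branch \<beta> w y = branch \<beta> w 0 + y / \<beta> ^ length w"
  using beta by (induction w) (auto simp: field_simps)

lemma branch_nonneg: "0 \<le> y \<Longrightarrow> 0 \<le> branch \<beta> w y"
  using beta by (induction w) auto

lemma branch_mono: "x \<le> y \<Longrightarrow> branch \<beta> w x \<le> branch \<beta> w y"
  using beta by (subst (1 2) branch_affine) (simp add: divide_right_mono)

lemma branch_itinerary:
  "x \<in> {0..<1} \<Longrightarrow> branch \<beta> (itinerary \<beta> n x) ((beta_map \<beta> ^^ n) x) = x"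
proof (induction n arbitrary: x)
  case (Suc n)
  then show ?case
    using digit_beta_map[of x] beta Suc.IH[of "beta_map \<beta> x"] beta_map_bounds[of \<beta> x]
    by (simp add: funpow_swap1 field_simps)
qed simp

lemma branch_valid_itinerary:
  assumes "x \<in> {0..<1}"
  shows "branch_valid \<beta> (itinerary \<beta> n x) ((beta_map \<beta> ^^ n) x)"
  unfolding branch_valid_def
proof (intro allI impI)
  fix j assume "j \<le> length (itinerary \<beta> n x)"
  then have j: "n = j + (n - j)" by simp
  have "drop j (itinerary \<beta> n x) = itinerary \<beta> (n - j) ((beta_map \<beta> ^^ j) x)"
    by (subst j, subst itinerary_add) simp
  moreover have "(beta_map \<beta> ^^ n) x = (beta_map \<beta> ^^ (n - j)) ((beta_map \<beta> ^^ j) x)"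
    by (metis j add.commute comp_apply funpow_add)
  ultimately have "branch \<beta> (drop j (itinerary \<beta> n x)) ((beta_map \<beta> ^^ n) x) = (beta_map \<beta> ^^ j) x"
    using branch_itinerary[OF beta_map_funpow_bounds[OF assms]] by simp
  then show "branch \<beta> (drop j (itinerary \<beta> n x)) ((beta_map \<beta> ^^ n) x) < 1"
    using beta_map_funpow_bounds[OF assms, where \<beta>=\<beta> and n=j] by simp
qed

lemma beta_map_branch:
  assumes "0 \<le> y" "branch_valid \<beta> (d # w) y"
  shows "beta_map \<beta> (branch \<beta> (d # w) y) = branch \<beta> w y"
  using assms branch_nonneg[OF assms(1), of w] beta_map_inverse_branch(1)[of "branch \<beta> w y" d]
  by (auto simp: branch_valid_def dest: spec[of _ 1])

text \<open>Since \<open>(d + y) / \<beta> < r\<close> means \<open>y < \<beta> r - d\<close>, reading a digit \<open>d\<close> intersects the condition \<open>y < 1\<close> with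
  the bound that comes from the previous state.\<close>

lemma less_range_end_iff:
  assumes "r \<le> 1"
  shows "y < range_end \<beta> r w \<longleftrightarrow>
    branch \<beta> w y < r \<and> (\<forall>j. 0 < j \<longrightarrow> j \<le> length w \<longrightarrow> branch \<beta> (drop j w) y < 1)"
  using assms
proof (induction w arbitrary: r)
  case (Cons d w)
  have "y < range_end \<beta> r (d # w) \<longleftrightarrow> branch \<beta> w y < min 1 (\<beta> * r - real d) \<and>
      (\<forall>j. 0 < j \<longrightarrow> j \<le> length w \<longrightarrow> branch \<beta> (drop j w) y < 1)"
    using Cons.IH[of "min 1 (\<beta> * r - real d)"] by simp
  also have "\<dots> \<longleftrightarrow> branch \<beta> (d # w) y < r \<and> (\<forall>j\<le>length w. branch \<beta> (drop j w) y < 1)"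
    using beta by (auto simp: field_simps) (metis drop0 le0 not_gr_zero)+
  also have "(\<forall>j\<le>length w. branch \<beta> (drop j w) y < 1) \<longleftrightarrow>
      (\<forall>j. 0 < j \<longrightarrow> j \<le> length (d # w) \<longrightarrow> branch \<beta> (drop j (d # w)) y < 1)"
    by (auto simp: drop_Cons' Suc_le_eq gr0_conv_Suc)
  finally show ?case .
qed simp

lemma branch_valid_iff: "branch_valid \<beta> w y \<longleftrightarrow> y < range_end \<beta> 1 w"
  unfolding branch_valid_def by (subst less_range_end_iff) (auto, metis drop0 gr_zeroI)

text \<open>Only the smaller side has to be a genuine itinerary: at the first difference its remainder is below \<open>1\<close>,
  hence below the gain of at least one unit in the digit on the other side.\<close>

lemma branch_less_if_lex_less:
  assumes "length u = length v" "u < v" "branch_valid \<beta> u x" "0 \<le> y"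
  shows "branch \<beta> u x < branch \<beta> v y"
  using assms
proof (induction u v rule: list_induct2)
  case (Cons a u b v)
  have valid: "branch_valid \<beta> u x" "branch \<beta> u x < 1"
    using Cons.prems(2) by (auto simp: branch_valid_def dest: spec[of _ "Suc _"] spec[of _ 1])
  consider "a < b" | "a = b" "u < v" using Cons.prems(1) by (auto simp: Cons_less_Cons)
  then show ?case
  proof cases
    case 1
    then have "real a + 1 \<le> real b" by simp
    then have "real a + branch \<beta> u x < real b + branch \<beta> v y"
      using valid(2) branch_nonneg[OF \<open>0 \<le> y\<close>, of v] by linarith
    then show ?thesis using beta by (simp add: divide_strict_right_mono)
  next
    case 2
    then show ?thesis using Cons.IH[OF 2(2) valid(1) Cons.prems(3)] beta by (simp add: divide_strict_right_mono)
  qed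
qed simp

lemma branch_valid_drop: "branch_valid \<beta> w y \<Longrightarrow> branch_valid \<beta> (drop m w) y"
  unfolding branch_valid_def by (metis add.commute drop_drop drop_all le_diff_conv length_drop nle_le)

lemma branch_valid_take:
  assumes "branch_valid \<beta> w y"
  shows "branch_valid \<beta> (take m w) (branch \<beta> (drop m w) y)"
  unfolding branch_valid_def
proof (intro allI impI)
  fix j assume j: "j \<le> length (take m w)"
  then have "drop j (take m w) @ drop m w = drop j w"
    by (metis append_take_drop_id drop_append diff_is_0_eq drop0)
  then have "branch \<beta> (drop j (take m w)) (branch \<beta> (drop m w) y) = branch \<beta> (drop j w) y"
    by (metis branch_append)
  then show "branch \<beta> (drop j (take m w)) (branch \<beta> (drop m w) y) < 1"
    using assms j by (simp add: branch_valid_def)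
qed

lemma branch_zero_mono_lex:
  assumes "u \<le> v" "branch_valid \<beta> u x" "0 \<le> x"
  shows "branch \<beta> u 0 \<le> branch \<beta> v 0"
proof -
  define m where "m = min (length u) (length v)"
  have "branch_valid \<beta> u 0"
    unfolding branch_valid_def
  proof (intro allI impI)
    fix j assume "j \<le> length u"
    then have "branch \<beta> (drop j u) x < 1" using assms(2) by (simp add: branch_valid_def)
    then show "branch \<beta> (drop j u) 0 < 1" using branch_mono[OF assms(3), of "drop j u"] by linarith
  qed
  then have valid: "branch_valid \<beta> (take m u) (branch \<beta> (drop m u) 0)"
    by (rule branch_valid_take)
  have eq: "branch \<beta> w 0 = branch \<beta> (take m w) (branch \<beta> (drop m w) 0)" for w
    by (metis append_take_drop_id branch_append)
  have "take m u \<le> take m v" using assms(1) by (intro take_mono_lex) (auto simp: m_def)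
  then consider "take m u < take m v" | "take m u = take m v" by fastforce
  then show ?thesis
  proof cases
    case 1
    then have "branch \<beta> u 0 < branch \<beta> v 0"
      unfolding eq[of u] eq[of v] using valid
      by (intro branch_less_if_lex_less branch_nonneg) (auto simp: m_def)
    then show ?thesis by simp
  next
    case 2
    have "m = length u"
    proof (rule ccontr)
      assume "m \<noteq> length u"
      then have "v = take m u" "u \<noteq> v" using 2 by (auto simp: m_def min_def split: if_splits)
      then have "v < u" using le_append[of "take m u" "drop m u"] by simp
      then show False using assms(1) by simp
    qed
    then show ?thesis
      unfolding eq[of u] eq[of v] 2 by (auto intro!: branch_mono branch_nonneg)
  qed
qed

text \<open>Here \<open>g\<close> ends at the last visit to the state \<open>1\<close>; from then on every digit is the last possible one.\<close>

lemma range_end_decomposition: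
  assumes "0 < range_end \<beta> 1 w"
  shows "\<exists>g j. w = g @ last_digits \<beta> j \<and> range_end \<beta> 1 w = (last_state \<beta> ^^ j) 1"
  using assms
proof (induction w rule: rev_induct)
  case Nil
  show ?case by (intro exI[of _ "[]"] exI[of _ 0]) (simp add: last_digits_def)
next
  case (snoc d w)
  define r where "r = range_end \<beta> 1 w"
  have r': "range_end \<beta> 1 (w @ [d]) = min 1 (\<beta> * r - real d)"
    by (simp add: range_end_append r_def)
  have "0 < \<beta> * r" using snoc.prems r' by (simp add: min_less_iff_conj)
  then have "0 < r" using beta by (simp add: zero_less_mult_iff)
  then obtain g j where gj: "w = g @ last_digits \<beta> j" "r = (last_state \<beta> ^^ j) 1"
    using snoc.IH unfolding r_def by blast
  show ?case
  proof (cases "\<beta> * r - real d \<ge> 1")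
    case True
    then show ?thesis
      using r' by (intro exI[of _ "w @ [d]"] exI[of _ 0]) (simp add: last_digits_def)
  next
    case False
    then have "0 < \<beta> * r - real d" "\<beta> * r - real d < 1"
      using snoc.prems r' by (auto simp: min_less_iff_conj)
    then have "\<lceil>\<beta> * r\<rceil> = int d + 1" by linarith
    then have "last_state \<beta> r = \<beta> * r - real d" "nat (\<lceil>\<beta> * r\<rceil> - 1) = d"
      by (simp_all add: last_state_def)
    then show ?thesis
      using r' False gj by (intro exI[of _ g] exI[of _ "Suc j"]) (simp add: last_digits_def)
  qed
qed

section \<open>The bifurcation set\<close>

lemma beta_map_funpow_right_affine:
  assumes "y \<in> {0..<1}"
  shows "\<exists>\<epsilon>>0. \<forall>u. y \<le> u \<longrightarrow> u < y + \<epsilon> \<longrightarrow>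
    (beta_map \<beta> ^^ n) u = (beta_map \<beta> ^^ n) y + \<beta> ^ n * (u - y)"
proof (induction n)
  case 0
  show ?case by (intro exI[of _ 1]) simp
next
  case (Suc n)
  then obtain \<epsilon> where \<epsilon>: "\<epsilon> > 0" "\<And>u. y \<le> u \<Longrightarrow> u < y + \<epsilon> \<Longrightarrow>
      (beta_map \<beta> ^^ n) u = (beta_map \<beta> ^^ n) y + \<beta> ^ n * (u - y)" by blast
  define z where "z = (beta_map \<beta> ^^ n) y"
  define \<delta> where "\<delta> = min \<epsilon> ((1 - beta_map \<beta> z) / \<beta> ^ Suc n)"
  have "\<delta> > 0"
    using \<epsilon>(1) beta beta_map_bounds(2)[of \<beta> z] by (simp add: \<delta>_def)
  moreover have "(beta_map \<beta> ^^ Suc n) u = (beta_map \<beta> ^^ Suc n) y + \<beta> ^ Suc n * (u - y)"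
    if u: "y \<le> u" "u < y + \<delta>" for u
  proof -
    have "u - y < (1 - beta_map \<beta> z) / \<beta> ^ Suc n" using u by (simp add: \<delta>_def)
    then have "\<beta> ^ Suc n * (u - y) < 1 - beta_map \<beta> z"
      using beta by (simp add: field_simps)
    moreover have "0 \<le> \<beta> ^ Suc n * (u - y)" using u beta by simp
    moreover have "\<beta> * ((beta_map \<beta> ^^ n) u) = \<beta> * z + \<beta> ^ Suc n * (u - y)"
    proof -
      have "(beta_map \<beta> ^^ n) u = z + \<beta> ^ n * (u - y)"
        unfolding z_def using u by (intro \<epsilon>(2)) (simp_all add: \<delta>_def)
      then show ?thesis by (simp add: distrib_left mult.assoc)
    qed
    ultimately have "frac (\<beta> * ((beta_map \<beta> ^^ n) u)) = frac (\<beta> * z) + \<beta> ^ Suc n * (u - y)"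
      by (simp add: beta_map_def frac_unique_iff) (simp add: frac_def)
    then show ?thesis by (simp add: beta_map_def z_def)
  qed
  ultimately show ?case by blast
qed

text \<open>If some iterate moves \<open>y\<close> below itself, then by continuity from the right it moves a whole interval
  \<open>[y, y + \<delta>)\<close> below \<open>y\<close>. Orbits that stay above \<open>y\<close> avoid this interval, so the survivor sets of \<open>y\<close> and \<open>y + \<delta>\<close>
  agree.\<close>

lemma bifurcation_set_iff:
  "y \<in> bifurcation_set \<beta> \<longleftrightarrow> y \<in> {0..<1} \<and> (\<forall>n. y \<le> (beta_map \<beta> ^^ n) y)"
proof (cases "y \<in> {0..<1}")
  case y: True
  show ?thesis
  proof (cases "\<forall>n. y \<le> (beta_map \<beta> ^^ n) y")
    case True
    have "survivor_set \<beta> t' \<noteq> survivor_set \<beta> y" if "t' > y" for t'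
    proof -
      have "y \<in> survivor_set \<beta> y" using y True by (simp add: survivor_set_def)
      moreover have "y \<notin> survivor_set \<beta> t'"
        using that by (auto simp: survivor_set_def intro!: exI[of _ 0])
      ultimately show ?thesis by blast
    qed
    then show ?thesis using True y by (simp add: bifurcation_set_def)
  next
    case False
    then obtain n where n: "(beta_map \<beta> ^^ n) y < y" by (auto simp: not_le)
    obtain \<epsilon> where \<epsilon>: "\<epsilon> > 0" "\<And>u. y \<le> u \<Longrightarrow> u < y + \<epsilon> \<Longrightarrow>
        (beta_map \<beta> ^^ n) u = (beta_map \<beta> ^^ n) y + \<beta> ^ n * (u - y)"
      using beta_map_funpow_right_affine[OF y] by blast
    define \<delta> where "\<delta> = min \<epsilon> ((y - (beta_map \<beta> ^^ n) y) / \<beta> ^ n)"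
    have "\<delta> > 0" using \<epsilon>(1) n beta by (simp add: \<delta>_def)
    have less: "(beta_map \<beta> ^^ n) u < y" if "y \<le> u" "u < y + \<delta>" for u
    proof -
      have "u - y < (y - (beta_map \<beta> ^^ n) y) / \<beta> ^ n" using that by (simp add: \<delta>_def)
      then have "\<beta> ^ n * (u - y) < y - (beta_map \<beta> ^^ n) y"
        using beta by (simp add: field_simps)
      then show ?thesis using \<epsilon>(2)[of u] that by (simp add: \<delta>_def)
    qed
    have "survivor_set \<beta> (y + \<delta>) = survivor_set \<beta> y"
    proof
      show "survivor_set \<beta> (y + \<delta>) \<subseteq> survivor_set \<beta> y"
        using \<open>\<delta> > 0\<close> by (force simp: survivor_set_def intro: order_trans[of y "y + \<delta>"])
      show "survivor_set \<beta> y \<subseteq> survivor_set \<beta> (y + \<delta>)"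
      proof
        fix x assume x: "x \<in> survivor_set \<beta> y"
        have "y + \<delta> \<le> (beta_map \<beta> ^^ k) x" for k
        proof (rule ccontr)
          assume "\<not> y + \<delta> \<le> (beta_map \<beta> ^^ k) x"
          then have "(beta_map \<beta> ^^ n) ((beta_map \<beta> ^^ k) x) < y"
            using x by (intro less) (auto simp: survivor_set_def)
          moreover have "(beta_map \<beta> ^^ n) ((beta_map \<beta> ^^ k) x) = (beta_map \<beta> ^^ (n + k)) x"
            by (simp add: funpow_add)
          ultimately show False using x by (auto simp: survivor_set_def not_le[symmetric])
        qed
        then show "x \<in> survivor_set \<beta> (y + \<delta>)" using x by (simp add: survivor_set_def)
      qed
    qed
    then show ?thesis using False \<open>\<delta> > 0\<close> by (auto simp: bifurcation_set_def intro!: exI[of _ "y + \<delta>"])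
  qed
qed (auto simp: bifurcation_set_def)

lemma bifurcation_subset_survivor: "bifurcation_set \<beta> \<inter> {t..1} \<subseteq> survivor_set \<beta> t"
  by (auto simp: bifurcation_set_iff survivor_set_def intro: order_trans)

lemma survivor_set_funpow: "x \<in> survivor_set \<beta> t \<Longrightarrow> (beta_map \<beta> ^^ n) x \<in> survivor_set \<beta> t"
  using beta_map_funpow_bounds[where x=x and \<beta>=\<beta> and n=n]
  by (auto simp: survivor_set_def simp flip: funpow_add[THEN fun_cong, unfolded o_def])

text \<open>The iterates have countably many inverse branches, all of them contractions.\<close>

lemma hausdorff_null_preimage:
  assumes "hausdorff_measure s A = 0" "0 < s"
  shows "hausdorff_measure s {x \<in> {0..<1}. (beta_map \<beta> ^^ n) x \<in> A} = 0"
proof -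
  have "dist (branch \<beta> w x) (branch \<beta> w y) \<le> dist x y" for w x y
  proof -
    have "branch \<beta> w x - branch \<beta> w y = (x - y) / \<beta> ^ length w"
      using branch_affine[of w x] branch_affine[of w y] by (simp add: diff_divide_distrib)
    then have "dist (branch \<beta> w x) (branch \<beta> w y) = dist x y / \<beta> ^ length w"
      using beta by (simp add: dist_real_def)
    also have "\<dots> \<le> dist x y / 1"
      using beta by (intro divide_left_mono one_le_power) auto
    finally show ?thesis by simp
  qed
  then have "hausdorff_measure s (\<Union>w. branch \<beta> w ` A) = 0"
    using assms by (intro hausdorff_null_UN_countable hausdorff_null_image_contraction) auto
  moreover have "{x \<in> {0..<1}. (beta_map \<beta> ^^ n) x \<in> A} \<subseteq> (\<Union>w. branch \<beta> w ` A)"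
  proof
    fix x assume "x \<in> {x \<in> {0..<1}. (beta_map \<beta> ^^ n) x \<in> A}"
    then have "x = branch \<beta> (itinerary \<beta> n x) ((beta_map \<beta> ^^ n) x)" "(beta_map \<beta> ^^ n) x \<in> A"
      by (simp_all add: branch_itinerary)
    then show "x \<in> (\<Union>w. branch \<beta> w ` A)" by blast
  qed
  ultimately show ?thesis by (rule hausdorff_null_subset)
qed

end

section \<open>Counting words by Lyndon words\<close>

lemma geometric_tail_le:
  fixes z :: real
  assumes "0 \<le> z" "z < 1"
  shows "(\<Sum>k=a..M. z ^ k) \<le> z ^ a / (1 - z)"
proof (cases "a \<le> M")
  case True
  then have "(\<Sum>k=a..M. z ^ k) = (z ^ a - z ^ Suc M) / (1 - z)"
    using assms by (simp add: sum_gp)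
  also have "\<dots> \<le> z ^ a / (1 - z)"
    using assms by (intro divide_right_mono) auto
  finally show ?thesis .
qed (use assms in auto)

lemma split_maximal_factors:
  fixes b :: "'a::linorder"
  assumes "set ls \<subseteq> insert b A" "sorted_wrt (\<ge>) ls" "\<forall>a\<in>A. a < b"
  shows "\<exists>k ls'. ls = replicate k b @ ls' \<and> set ls' \<subseteq> A \<and> sorted_wrt (\<ge>) ls'"
  using assms
proof (induction ls)
  case Nil
  show ?case by (intro exI[of _ 0] exI[of _ "[]"]) simp
next
  case (Cons a ls)
  show ?case
  proof (cases "a = b")
    case True
    obtain k ls' where "ls = replicate k b @ ls'" "set ls' \<subseteq> A" "sorted_wrt (\<ge>) ls'"
      using Cons by auto
    then show ?thesis using True by (intro exI[of _ "Suc k"] exI[of _ ls']) simp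
  next
    case False
    then have "a < b" using Cons.prems by auto
    then have "b \<notin> set ls" using Cons.prems(2) by auto
    then show ?thesis
      using Cons.prems False by (intro exI[of _ 0] exI[of _ "a # ls"]) auto
  qed
qed

definition nonincreasing_products :: "'a::linorder list set \<Rightarrow> nat \<Rightarrow> 'a list set" where
  "nonincreasing_products S M =
     {concat ls | ls. set ls \<subseteq> S \<and> sorted_wrt (\<ge>) ls \<and> length (concat ls) \<le> M}"

text \<open>A nonincreasing product is determined by the multiplicities of its factors, so the sum is at most the
  expanded product of geometric series. The induction separates the powers of the largest factor, which
  come first.\<close>

lemma nonincreasing_products_weight:
  fixes S :: "'a::linorder list set" and z :: real
  assumes "finite S" "[] \<notin> S" "0 < z" "z < 1"
  shows "finite (nonincreasing_products S M) \<and>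
    (\<Sum>w\<in>nonincreasing_products S M. z ^ length w) \<le> (\<Prod>l\<in>S. 1 / (1 - z ^ length l))"
  using assms
proof (induction S rule: finite_linorder_max_induct)
  case empty
  have "nonincreasing_products {} M = {[] :: 'a list}" by (auto simp: nonincreasing_products_def)
  then show ?case by simp
next
  case (insert b A)
  define P where "P = nonincreasing_products A M"
  have P: "finite P" "(\<Sum>w\<in>P. z ^ length w) \<le> (\<Prod>l\<in>A. 1 / (1 - z ^ length l))"
    using insert by (auto simp: P_def)
  define f where "f = (\<lambda>(k, w). concat (replicate k b) @ w)"
  have len: "length (concat (replicate k b)) = k * length b" for k
    by (induction k) auto
  have "b \<noteq> []" using insert.prems by auto
  have sub: "nonincreasing_products (insert b A) M \<subseteq> f ` ({..M} \<times> P)"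
  proof
    fix w assume "w \<in> nonincreasing_products (insert b A) M"
    then obtain ls where ls: "w = concat ls" "set ls \<subseteq> insert b A" "sorted_wrt (\<ge>) ls"
       "length (concat ls) \<le> M"
      by (auto simp: nonincreasing_products_def)
    obtain k ls' where ls': "ls = replicate k b @ ls'" "set ls' \<subseteq> A" "sorted_wrt (\<ge>) ls'"
      using split_maximal_factors[OF ls(2,3)] insert.hyps by blast
    have "k * length b + length (concat ls') \<le> M"
      using ls(4) by (simp add: ls'(1) len)
    moreover have "k \<le> k * length b"
      using \<open>b \<noteq> []\<close> by (cases b) auto
    ultimately have "k \<le> M" "length (concat ls') \<le> M" by linarith+
    then have "concat ls' \<in> P"
      using ls' by (auto simp: P_def nonincreasing_products_def)
    then show "w \<in> f ` ({..M} \<times> P)"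
      using ls(1) ls'(1) \<open>k \<le> M\<close> by (intro image_eqI[of _ _ "(k, concat ls')"]) (auto simp: f_def)
  qed
  define x where "x = z ^ length b"
  have x: "0 < x" "x < 1"
    using insert.prems \<open>b \<noteq> []\<close> by (auto simp: x_def power_less_one_iff)
  have "(\<Sum>w\<in>nonincreasing_products (insert b A) M. z ^ length w) \<le> (\<Sum>w\<in>f ` ({..M} \<times> P). z ^ length w)"
    using P(1) insert.prems sub by (intro sum_mono2) auto
  also have "\<dots> \<le> (\<Sum>kw\<in>{..M} \<times> P. z ^ length (f kw))"
    using P(1) insert.prems sum_image_le[of "{..M} \<times> P" "\<lambda>w. z ^ length w" f] by (simp add: o_def)
  also have "\<dots> = (\<Sum>(k, w)\<in>{..M} \<times> P. x ^ k * z ^ length w)"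
    by (intro sum.cong) (auto simp: f_def len x_def power_add mult.commute simp flip: power_mult)
  also have "\<dots> = (\<Sum>k\<le>M. x ^ k) * (\<Sum>w\<in>P. z ^ length w)"
    by (simp add: sum_product sum.cartesian_product)
  also have "\<dots> \<le> 1 / (1 - x) * (\<Prod>l\<in>A. 1 / (1 - z ^ length l))"
    using P(2) x geometric_tail_le[of x 0 M] insert.prems
    by (intro mult_mono) (auto simp: atMost_atLeast0 intro!: sum_nonneg)
  also have "\<dots> = (\<Prod>l\<in>insert b A. 1 / (1 - z ^ length l))"
    using insert.hyps by (subst prod.insert) (auto simp: x_def)
  finally show ?case
    using finite_subset[OF sub] P(1) by auto
qed

lemma prod_geometric_le_exp:
  fixes z :: real
  assumes "[] \<notin> S" "0 < z" "z < 1"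
  shows "(\<Prod>l\<in>S. 1 / (1 - z ^ length l)) \<le> exp ((\<Sum>l\<in>S. z ^ length l) / (1 - z))"
proof (cases "finite S")
  case True
  have "0 \<le> 1 / (1 - z ^ length l) \<and> 1 / (1 - z ^ length l) \<le> exp (z ^ length l / (1 - z))" if "l \<in> S" for l
  proof -
    define x where "x = z ^ length l"
    have "l \<noteq> []" using that assms(1) by auto
    then have x: "0 < x" "x \<le> z" "x < 1"
      using assms power_decreasing[of 1 "length l" z] by (auto simp: x_def Suc_le_eq power_less_one_iff)
    have "1 / (1 - x) = 1 + x / (1 - x)" using x by (simp add: field_simps)
    also have "\<dots> \<le> 1 + x / (1 - z)" using x assms by (intro add_left_mono divide_left_mono) auto
    also have "\<dots> \<le> exp (x / (1 - z))" by (rule exp_ge_add_one_self)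
    finally show ?thesis using x unfolding x_def by simp
  qed
  then have "(\<Prod>l\<in>S. 1 / (1 - z ^ length l)) \<le> (\<Prod>l\<in>S. exp (z ^ length l / (1 - z)))"
    by (intro prod_mono) auto
  also have "\<dots> = exp (\<Sum>l\<in>S. z ^ length l / (1 - z))" using True by (simp add: exp_sum)
  finally show ?thesis by (simp add: sum_divide_distrib)
qed simp

text \<open>As \<open>branch \<beta> l 0\<close> is the left end of the cylinder of \<open>l\<close>, the words below come from points of the survivor set
  and begin to the left of \<open>b\<close>.\<close>

definition survivor_lyndon_words :: "real \<Rightarrow> real \<Rightarrow> real \<Rightarrow> nat \<Rightarrow> nat list set" where
  "survivor_lyndon_words \<beta> c b M = {l. lyndon l \<and> length l \<le> M \<and> branch \<beta> l 0 < b \<and>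
     (\<exists>x\<in>survivor_set \<beta> c. itinerary \<beta> (length l) x = l)}"

definition survivor_words :: "real \<Rightarrow> real \<Rightarrow> real \<Rightarrow> nat \<Rightarrow> nat list set" where
  "survivor_words \<beta> c b n = itinerary \<beta> n ` (survivor_set \<beta> c \<inter> {..<b})"

definition periodic_prolongation :: "nat list \<Rightarrow> nat \<Rightarrow> nat list" where
  "periodic_prolongation p k = map (\<lambda>i. p ! (i mod length p)) [0..<k]"

lemma periodic_eq_prolongation:
  assumes "0 < m" "m \<le> length g" "\<And>i. i + m < length g \<Longrightarrow> g ! (i + m) = g ! i"
  shows "g = periodic_prolongation (take m g) (length g)"
proof (rule nth_equalityI)
  have "i < length g \<Longrightarrow> g ! i = g ! (i mod m)" for i
  proof (induction i rule: less_induct)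
    case (less i)
    show ?case
    proof (cases "i < m")
      case False
      then have "g ! i = g ! (i - m)" using assms(3)[of "i - m"] less.prems by simp
      also have "\<dots> = g ! ((i - m) mod m)" using less.prems False assms(1) by (intro less.IH) auto
      finally show ?thesis using False by (simp add: le_mod_geq)
    qed simp
  qed
  then show "g ! i = periodic_prolongation (take m g) (length g) ! i" if "i < length g" for i
    using that assms by (simp add: periodic_prolongation_def min_absorb2)
qed (simp add: periodic_prolongation_def)

lemma survivor_set_bounds: "x \<in> survivor_set \<beta> c \<Longrightarrow> x \<in> {0..<1}" "x \<in> survivor_set \<beta> c \<Longrightarrow> c \<le> x"
  by (auto simp: survivor_set_def dest: spec[of _ 0])

context
  fixes \<beta> :: real
  assumes beta: "1 < \<beta>"
begin

lemma set_itinerary: "x \<in> {0..<1} \<Longrightarrow> set (itinerary \<beta> n x) \<subseteq> {..nat \<lfloor>\<beta>\<rfloor>}"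
proof (induction n arbitrary: x)
  case (Suc n)
  have "\<beta> * x \<le> \<beta>" using Suc.prems beta by simp
  then have "digit \<beta> x \<le> nat \<lfloor>\<beta>\<rfloor>"
    unfolding digit_def by (intro nat_mono floor_mono)
  then show ?case using Suc.IH[of "beta_map \<beta> x"] beta_map_bounds[of \<beta> x] by auto
qed simp

lemma finite_itineraries: "finite {w. length w \<le> M \<and> (\<exists>n. \<exists>x\<in>{0..<1}. w = itinerary \<beta> n x)}"
proof (rule finite_subset)
  show "finite {w. set w \<subseteq> {..nat \<lfloor>\<beta>\<rfloor>} \<and> length w \<le> M}"
    by (rule finite_lists_length_le) simp
  show "{w. length w \<le> M \<and> (\<exists>n. \<exists>x\<in>{0..<1}. w = itinerary \<beta> n x)}
      \<subseteq> {w. set w \<subseteq> {..nat \<lfloor>\<beta>\<rfloor>} \<and> length w \<le> M}"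
    using set_itinerary by blast
qed

lemma finite_survivor_lyndon_words: "finite (survivor_lyndon_words \<beta> c b M)"
proof (rule finite_subset[OF _ finite_itineraries[of M]])
  show "survivor_lyndon_words \<beta> c b M
      \<subseteq> {w. length w \<le> M \<and> (\<exists>n. \<exists>x\<in>{0..<1}. w = itinerary \<beta> n x)}"
  proof
    fix w assume "w \<in> survivor_lyndon_words \<beta> c b M"
    then obtain x where "x \<in> survivor_set \<beta> c" "w = itinerary \<beta> (length w) x" "length w \<le> M"
      by (auto simp: survivor_lyndon_words_def)
    then show "w \<in> {w. length w \<le> M \<and> (\<exists>n. \<exists>x\<in>{0..<1}. w = itinerary \<beta> n x)}"
      using survivor_set_bounds(1) by blast
  qed
qed

lemma finite_survivor_words: "finite (survivor_words \<beta> c b n)"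
proof (rule finite_subset[OF _ finite_itineraries[of n]])
  show "survivor_words \<beta> c b n
      \<subseteq> {w. length w \<le> n \<and> (\<exists>n. \<exists>x\<in>{0..<1}. w = itinerary \<beta> n x)}"
  proof
    fix w assume "w \<in> survivor_words \<beta> c b n"
    then obtain x where "x \<in> survivor_set \<beta> c" "w = itinerary \<beta> n x"
      by (auto simp: survivor_words_def)
    then show "w \<in> {w. length w \<le> n \<and> (\<exists>n. \<exists>x\<in>{0..<1}. w = itinerary \<beta> n x)}"
      using survivor_set_bounds(1)[of x \<beta> c] by (intro CollectI conjI exI[of _ n] bexI[of _ x]) simp_all
  qed
qed

text \<open>Factors of itineraries are itineraries of later points of the orbit, hence belong to the survivor set. The
  bound \<open>b\<close> is passed on from the first factor to all others because the factors are nonincreasing.\<close>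

lemma survivor_words_lyndon_products:
  assumes "n \<le> M"
  shows "survivor_words \<beta> c b n \<subseteq> nonincreasing_products (survivor_lyndon_words \<beta> c b M) M"
proof
  fix w assume "w \<in> survivor_words \<beta> c b n"
  then obtain x where x: "x \<in> survivor_set \<beta> c" "x < b" "w = itinerary \<beta> n x"
    by (auto simp: survivor_words_def)
  obtain ls where ls: "w = concat ls" "\<forall>l\<in>set ls. lyndon l" "sorted_wrt (\<ge>) ls"
    using lyndon_factorisation by blast
  have factor: "\<exists>y\<in>survivor_set \<beta> c. v = itinerary \<beta> (length v) y \<and> (u = [] \<longrightarrow> y = x)" if "w = u @ v @ v'" for u v v'
  proof -
    have len: "n = length u + (length v + length v')"
      using that x(3) by (metis length_append length_itinerary)
    define y where "y = (beta_map \<beta> ^^ length u) x"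
    have "u @ v @ v' = itinerary \<beta> (length u) x @ itinerary \<beta> (length v) y @
        itinerary \<beta> (length v') ((beta_map \<beta> ^^ length v) y)"
      using that x(3) by (simp add: len itinerary_add y_def)
    then have "v = itinerary \<beta> (length v) y" by simp
    moreover have "y \<in> survivor_set \<beta> c" unfolding y_def using beta x(1) by (rule survivor_set_funpow)
    ultimately show ?thesis by (auto simp: y_def)
  qed
  have "l \<in> survivor_lyndon_words \<beta> c b M" if l: "l \<in> set ls" for l
  proof -
    obtain us vs where "ls = us @ l # vs" using l by (meson split_list)
    then have w: "w = concat us @ l @ concat vs" using ls(1) by simp
    obtain y where y: "y \<in> survivor_set \<beta> c" "l = itinerary \<beta> (length l) y"
      using factor[OF w] by blast
    have "length w = n" by (simp add: x(3))
    then have "length l \<le> M" using w assms by simp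
    obtain k ls' where k: "ls = k # ls'" using l by (cases ls) auto
    have "l \<le> k" using ls(3) l by (auto simp: k)
    have "k = itinerary \<beta> (length k) x"
      using factor[of "[]" k "concat ls'"] ls(1) by (auto simp: k)
    then have "branch \<beta> k ((beta_map \<beta> ^^ length k) x) = x"
      using branch_itinerary[OF beta survivor_set_bounds(1)[OF x(1)], of "length k"] by simp
    then have "branch \<beta> k 0 \<le> x"
      using branch_mono[OF beta, of 0 "(beta_map \<beta> ^^ length k) x" k]
        beta_map_funpow_bounds[OF survivor_set_bounds(1)[OF x(1)], of "length k" \<beta>] by simp
    moreover have "branch \<beta> l 0 \<le> branch \<beta> k 0"
      using branch_valid_itinerary[OF beta survivor_set_bounds(1)[OF y(1)], of "length l"] y(2)
        beta_map_funpow_bounds[OF survivor_set_bounds(1)[OF y(1)], of "length l" \<beta>]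
      by (intro branch_zero_mono_lex[OF beta \<open>l \<le> k\<close>]) auto
    ultimately have "branch \<beta> l 0 < b" using x(2) by linarith
    then show ?thesis
      using y ls(2) l \<open>length l \<le> M\<close> by (auto simp: survivor_lyndon_words_def intro!: bexI[of _ y])
  qed
  then show "w \<in> nonincreasing_products (survivor_lyndon_words \<beta> c b M) M"
    using ls assms x(3) unfolding nonincreasing_products_def
    by (intro CollectI exI[of _ ls]) (metis length_itinerary subsetI)
qed

text \<open>A bound on the weights of the Lyndon words bounds the product of geometric series, hence the total
  weight of all words. The weights of the words of length \<open>n\<close> then tend to \<open>0\<close>, and they dominate the
  premeasure given by the cover with cylinders of order \<open>n\<close>.\<close>

lemma null_if_lyndon_sums_bounded:
  assumes "0 < s" and z: "z = \<beta> powr (-s)"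
    and bounded: "\<And>M. (\<Sum>l\<in>survivor_lyndon_words \<beta> c b M. z ^ length l) \<le> B"
  shows "hausdorff_measure s (survivor_set \<beta> c \<inter> {..<b}) = 0"
proof -
  have z01: "0 < z" "z < 1" using beta \<open>0 < s\<close> by (auto simp: z powr_less_one)
  have no_nil: "[] \<notin> survivor_lyndon_words \<beta> c b M" for M
    by (simp add: survivor_lyndon_words_def lyndon_def)
  have len: "length w = n" if "w \<in> survivor_words \<beta> c b n" for w n
    using that by (auto simp: survivor_words_def)
  have "(\<Sum>n<M. real (card (survivor_words \<beta> c b n)) * z ^ n) \<le> exp (B / (1 - z))" for M
  proof -
    define S where "S = survivor_lyndon_words \<beta> c b M"
    have "(\<Sum>n<M. real (card (survivor_words \<beta> c b n)) * z ^ n) = (\<Sum>n<M. \<Sum>w\<in>survivor_words \<beta> c b n. z ^ length w)"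
      using len by (intro sum.cong) simp_all
    also have "\<dots> = (\<Sum>w\<in>(\<Union>n<M. survivor_words \<beta> c b n). z ^ length w)"
      using finite_survivor_words len by (intro sum.UNION_disjoint[symmetric]) (simp, simp, metis disjoint_iff)
    also have "\<dots> \<le> (\<Sum>w\<in>nonincreasing_products S M. z ^ length w)"
    proof (intro sum_mono2)
      show "finite (nonincreasing_products S M)"
        using nonincreasing_products_weight[OF finite_survivor_lyndon_words no_nil z01] by (simp add: S_def)
      show "(\<Union>n<M. survivor_words \<beta> c b n) \<subseteq> nonincreasing_products S M"
        using survivor_words_lyndon_products unfolding S_def by (intro UN_least) simp
    qed (use z01 in auto)
    also have "\<dots> \<le> (\<Prod>l\<in>S. 1 / (1 - z ^ length l))"
      using nonincreasing_products_weight[OF finite_survivor_lyndon_words no_nil z01] by (simp add: S_def)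
    also have "\<dots> \<le> exp ((\<Sum>l\<in>S. z ^ length l) / (1 - z))"
      using prod_geometric_le_exp[OF no_nil z01] by (simp add: S_def)
    also have "\<dots> \<le> exp (B / (1 - z))"
      using bounded[of M] z01 by (simp add: S_def divide_right_mono)
    finally show ?thesis .
  qed
  then have "summable (\<lambda>n. real (card (survivor_words \<beta> c b n)) * z ^ n)"
    using z01 by (intro summableI_nonneg_bounded) auto
  then have lim: "(\<lambda>n. real (card (survivor_words \<beta> c b n)) * z ^ n) \<longlonglongrightarrow> 0"
    by (rule summable_LIMSEQ_zero)
  have pow: "((1/\<beta>) ^ n) powr s = z ^ n" for n
  proof -
    have "((1/\<beta>) ^ n) powr s = ((1/\<beta>) powr real n) powr s" using beta by (simp add: powr_realpow)
    also have "\<dots> = (\<beta> powr (-s)) powr real n"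
      using beta by (simp add: powr_powr powr_minus powr_divide field_simps)
    also have "\<dots> = z ^ n" using z01 z by (simp add: powr_realpow)
    finally show ?thesis .
  qed
  show ?thesis
  proof (rule hausdorff_null_finite_covers[where r = "\<lambda>n. (1/\<beta>) ^ n" and C = "survivor_words \<beta> c b"
        and V = "\<lambda>n w. {x \<in> {0..<1}. itinerary \<beta> n x = w}"])
    show "(\<lambda>n. (1/\<beta>) ^ n) \<longlonglongrightarrow> 0" using beta by (intro LIMSEQ_realpow_zero) auto
    show "survivor_set \<beta> c \<inter> {..<b} \<subseteq> (\<Union>w\<in>survivor_words \<beta> c b n. {x \<in> {0..<1}. itinerary \<beta> n x = w})" for n
      using survivor_set_bounds(1) by (auto simp: survivor_words_def)
    show "dist x y \<le> (1/\<beta>) ^ n" if "x \<in> {x \<in> {0..<1}. itinerary \<beta> n x = w}"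
      "y \<in> {x \<in> {0..<1}. itinerary \<beta> n x = w}" for n w x y
    proof -
      define x' y' where "x' = (beta_map \<beta> ^^ n) x" and "y' = (beta_map \<beta> ^^ n) y"
      have "x' \<in> {0..<1}" "y' \<in> {0..<1}"
        using that by (auto simp: x'_def y'_def simp del: atLeastLessThan_iff intro!: beta_map_funpow_bounds)
      then have "\<bar>x' - y'\<bar> \<le> 1" by auto
      have "x = branch \<beta> w x'" "y = branch \<beta> w y'" "length w = n"
        using that branch_itinerary[OF beta, of x n] branch_itinerary[OF beta, of y n]
        unfolding x'_def y'_def by auto
      then have "x - y = (x' - y') / \<beta> ^ n"
        using branch_affine[OF beta, of w x'] branch_affine[OF beta, of w y'] by (simp add: diff_divide_distrib)
      then have "dist x y = \<bar>x' - y'\<bar> / \<beta> ^ n" using beta by (simp add: dist_real_def)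
      also have "\<dots> \<le> 1 / \<beta> ^ n" using \<open>\<bar>x' - y'\<bar> \<le> 1\<close> beta by (intro divide_right_mono) auto
      finally show ?thesis by (simp add: power_one_over)
    qed
  qed (use assms(1) lim finite_survivor_words beta in \<open>simp_all add: pow\<close>)
qed

text \<open>After the word the orbit goes on at a point of the survivor set, which is at least \<open>c\<close> and lies below
  the end of the range.\<close>

lemma survivor_lyndon_word_range_end:
  assumes "l \<in> survivor_lyndon_words \<beta> c b M"
  shows "c < range_end \<beta> 1 l" "0 < range_end \<beta> 1 l"
proof -
  obtain x where x: "x \<in> survivor_set \<beta> c" "itinerary \<beta> (length l) x = l"
    using assms by (auto simp: survivor_lyndon_words_def)
  define y where "y = (beta_map \<beta> ^^ length l) x"
  have "y < range_end \<beta> 1 l"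
    using branch_valid_itinerary[OF beta survivor_set_bounds(1)[OF x(1)], of "length l"] x(2)
    by (simp add: branch_valid_iff[OF beta] y_def)
  moreover have "y \<in> survivor_set \<beta> c"
    unfolding y_def using beta x(1) by (rule survivor_set_funpow)
  ultimately show "c < range_end \<beta> 1 l" "0 < range_end \<beta> 1 l"
    using survivor_set_bounds[of y \<beta> c] by auto
qed

lemma survivor_lyndon_word_prefix:
  assumes "l \<in> survivor_lyndon_words \<beta> c b M" "lyndon (take m l)"
  shows "take m l \<in> survivor_lyndon_words \<beta> c b M"
proof -
  obtain x where x: "x \<in> survivor_set \<beta> c" "itinerary \<beta> (length l) x = l"
    using assms(1) by (auto simp: survivor_lyndon_words_def)
  define k where "k = length (take m l)"
  have "length l = k + (length l - k)" by (simp add: k_def)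
  then have "l = itinerary \<beta> k x @ itinerary \<beta> (length l - k) ((beta_map \<beta> ^^ k) x)"
    using x(2) itinerary_add[of \<beta> k "length l - k" x] by simp
  then have it: "take m l = itinerary \<beta> k x"
    by (metis append_eq_conv_conj append_take_drop_id k_def length_itinerary)
  have "take m l \<le> l" using le_append[of "take m l" "drop m l"] by simp
  then have "branch \<beta> (take m l) 0 \<le> branch \<beta> l 0"
    using branch_valid_itinerary[OF beta survivor_set_bounds(1)[OF x(1)], of k]
      beta_map_funpow_bounds[OF survivor_set_bounds(1)[OF x(1)], of k \<beta>]
    by (intro branch_zero_mono_lex[OF beta]) (auto simp: it)
  moreover have "itinerary \<beta> (length (take m l)) x = take m l"
    using it by (simp only: k_def)
  moreover have "branch \<beta> l 0 < b" "length (take m l) \<le> M"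
    using assms(1) by (auto simp: survivor_lyndon_words_def)
  ultimately show ?thesis
    unfolding survivor_lyndon_words_def using assms(2) x(1) by force
qed

text \<open>A word counted on the left is a prefix \<open>g\<close> followed by \<open>last_digits \<beta> j\<close> with \<open>j \<ge> J\<close>; the sum over \<open>j\<close> gives
  the factor \<open>z ^ J / (1 - z)\<close>. The prefix \<open>g\<close> is empty or the prolongation to some length of a Lyndon word of the
  same family, and the sum over the lengths gives the other \<open>1 / (1 - z)\<close>.\<close>

lemma late_return_sum_le:
  fixes c b z :: real and M J :: nat
  assumes "0 < z" "z < 1"
  defines "\<Lambda> \<equiv> survivor_lyndon_words \<beta> c b M"
  shows "(\<Sum>l\<in>{l\<in>\<Lambda>. range_end \<beta> 1 l \<notin> early_states \<beta> J}. z ^ length l)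
    \<le> z ^ J / (1 - z) * (1 + (\<Sum>l\<in>\<Lambda>. z ^ length l) / (1 - z))"
proof -
  define I where "I = (SIGMA p:\<Lambda>. {length p..M})"
  define G where "G = insert [] ((\<lambda>(p, k). periodic_prolongation p k) ` I)"
  define f where "f = (\<lambda>(g, j). g @ last_digits \<beta> j)"
  have fin: "finite \<Lambda>" "finite I" "finite G"
    using finite_survivor_lyndon_words[of c b M] by (auto simp: \<Lambda>_def I_def G_def)
  have sub: "{l\<in>\<Lambda>. range_end \<beta> 1 l \<notin> early_states \<beta> J} \<subseteq> f ` (G \<times> {J..M})"
  proof
    fix l assume "l \<in> {l\<in>\<Lambda>. range_end \<beta> 1 l \<notin> early_states \<beta> J}"
    then have l: "l \<in> \<Lambda>" "range_end \<beta> 1 l \<notin> early_states \<beta> J" "lyndon l" "length l \<le> M"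
      by (auto simp: \<Lambda>_def survivor_lyndon_words_def)
    obtain g j where gj: "l = g @ last_digits \<beta> j" "range_end \<beta> 1 l = (last_state \<beta> ^^ j) 1"
      using range_end_decomposition[OF beta survivor_lyndon_word_range_end(2)] l(1) unfolding \<Lambda>_def by blast
    have "\<not> j < J" using l(2) gj(2) by (auto simp: early_states_def)
    moreover have "j \<le> M" using l(4) gj(1) by (simp add: last_digits_def)
    moreover have "g \<in> G"
    proof (cases "g = []")
      case False
      have "take (length g - i) g \<le> drop i g" if i: "i < length g" for i
      proof (cases "i = 0")
        case False
        have "take (length l - i) l < drop i l"
        proof -
          have "i < length l" using i gj(1) by simp
          then show ?thesis using l(3) False unfolding lyndon_def by blast
        qed
        then have "take (length g - i) (take (length l - i) l) \<le> take (length g - i) (drop i l)"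
          using i gj(1) by (intro take_mono_lex) auto
        then show ?thesis using i gj(1) by (simp add: min_absorb1)
      qed simp
      from lyndon_prefix_periodic[OF False this] obtain m
        where m: "0 < m" "m \<le> length g" "lyndon (take m g)" "\<And>i. i + m < length g \<Longrightarrow> g ! (i + m) = g ! i"
        by blast
      have "take m g = take m l" using m(2) gj(1) by simp
      then have "take m g \<in> \<Lambda>"
        using survivor_lyndon_word_prefix[of l c b M m] l(1) m(3) by (simp add: \<Lambda>_def)
      moreover have "length g \<le> M" using l(4) gj(1) by simp
      ultimately have "(take m g, length g) \<in> I" using m(2) by (simp add: I_def)
      then have "periodic_prolongation (take m g) (length g) \<in> G"
        unfolding G_def by (intro insertI2 image_eqI[of _ _ "(take m g, length g)"]) auto
      then show ?thesis using periodic_eq_prolongation[OF m(1,2,4)] by simp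
    qed (simp add: G_def)
    ultimately have "(g, j) \<in> G \<times> {J..M}" by simp
    moreover have "l = f (g, j)" by (simp add: f_def gj(1))
    ultimately show "l \<in> f ` (G \<times> {J..M})" by (rule image_eqI[rotated])
  qed
  have "(\<Sum>g\<in>(\<lambda>(p, k). periodic_prolongation p k) ` I. z ^ length g) \<le> (\<Sum>(p, k)\<in>I. z ^ k)"
    using sum_image_le[of I "\<lambda>g. z ^ length g" "\<lambda>(p, k). periodic_prolongation p k"] fin assms(1)
    by (simp add: o_def split_def periodic_prolongation_def)
  also have "\<dots> = (\<Sum>p\<in>\<Lambda>. \<Sum>k=length p..M. z ^ k)"
    unfolding I_def using fin by (subst sum.Sigma) auto
  also have "\<dots> \<le> (\<Sum>p\<in>\<Lambda>. z ^ length p / (1 - z))"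
    using assms(1,2) by (intro sum_mono geometric_tail_le) auto
  finally have "(\<Sum>g\<in>G. z ^ length g) \<le> 1 + (\<Sum>l\<in>\<Lambda>. z ^ length l) / (1 - z)"
    unfolding G_def using fin assms(1) by (simp add: sum.insert_if sum_divide_distrib)
  moreover have "(\<Sum>l\<in>{l\<in>\<Lambda>. range_end \<beta> 1 l \<notin> early_states \<beta> J}. z ^ length l) \<le> (\<Sum>l\<in>f ` (G \<times> {J..M}). z ^ length l)"
    using sub fin assms(1) by (intro sum_mono2) auto
  moreover have "(\<Sum>l\<in>f ` (G \<times> {J..M}). z ^ length l) \<le> (\<Sum>gj\<in>G \<times> {J..M}. z ^ length (f gj))"
    using fin assms(1) sum_image_le[of "G \<times> {J..M}" "\<lambda>w. z ^ length w" f] by (simp add: o_def)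
  moreover have "(\<Sum>gj\<in>G \<times> {J..M}. z ^ length (f gj)) = (\<Sum>g\<in>G. z ^ length g) * (\<Sum>j=J..M. z ^ j)"
    by (simp add: sum_product sum.cartesian_product f_def split_def power_add last_digits_def)
  moreover have "(\<Sum>g\<in>G. z ^ length g) * (\<Sum>j=J..M. z ^ j)
      \<le> (1 + (\<Sum>l\<in>\<Lambda>. z ^ length l) / (1 - z)) * (z ^ J / (1 - z))"
    using calculation(1) assms(1,2) geometric_tail_le[of z J M]
    by (intro mult_mono) (auto intro!: sum_nonneg add_nonneg_nonneg divide_nonneg_nonneg)
  ultimately show ?thesis by (simp add: mult.commute)
qed

end

section \<open>Choosing a family of blocks\<close>

context
  fixes \<beta> :: real
  assumes beta: "1 < \<beta>"
begin

text \<open>It matters that \<open>J\<close> depends on \<open>z\<close> only: the set of states is fixed before \<open>c\<close> and \<open>b\<close> are chosen in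
  terms of it.\<close>

lemma early_lyndon_sums_unbounded:
  assumes "0 < s" and z: "z = \<beta> powr (-s)"
  shows "\<exists>J. \<forall>c b. hausdorff_measure s (survivor_set \<beta> c \<inter> {..<b}) \<noteq> 0 \<longrightarrow>
    (\<forall>B. \<exists>M. B < (\<Sum>l\<in>{l\<in>survivor_lyndon_words \<beta> c b M. range_end \<beta> 1 l \<in> early_states \<beta> J}. z ^ length l))"
proof -
  have z01: "0 < z" "z < 1" using beta \<open>0 < s\<close> by (auto simp: z powr_less_one)
  \<comment> \<open>Then the coefficient of the total weight in the bound of \<open>late_return_sum_le\<close> is at most \<open>1/2\<close>.\<close>
  obtain J where J: "z ^ J < (1 - z)\<^sup>2 / 2"
    using real_arch_pow_inv[of "(1 - z)\<^sup>2 / 2" z] z01 by auto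
  define K where "K = z ^ J / (1 - z)"
  have "K / (1 - z) \<le> 1/2"
  proof -
    have "K / (1 - z) = z ^ J / (1 - z)\<^sup>2" by (simp add: K_def power2_eq_square)
    also have "\<dots> \<le> ((1 - z)\<^sup>2 / 2) / (1 - z)\<^sup>2" using J by (intro divide_right_mono) auto
    also have "\<dots> = 1/2" using z01 by simp
    finally show ?thesis .
  qed
  have "hausdorff_measure s (survivor_set \<beta> c \<inter> {..<b}) = 0"
    if bounded: "\<And>M. (\<Sum>l\<in>{l\<in>survivor_lyndon_words \<beta> c b M. range_end \<beta> 1 l \<in> early_states \<beta> J}. z ^ length l) \<le> B"
    for c b B
  proof (rule null_if_lyndon_sums_bounded[OF beta \<open>0 < s\<close> z, where B = "2 * (B + K)"])
    fix M
    define \<Lambda> where "\<Lambda> = survivor_lyndon_words \<beta> c b M"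
    define \<Sigma> where "\<Sigma> = (\<Sum>l\<in>\<Lambda>. z ^ length l)"
    have "finite \<Lambda>" unfolding \<Lambda>_def by (rule finite_survivor_lyndon_words[OF beta])
    then have "\<Sigma> = (\<Sum>l\<in>{l\<in>\<Lambda>. range_end \<beta> 1 l \<in> early_states \<beta> J}. z ^ length l)
        + (\<Sum>l\<in>{l\<in>\<Lambda>. range_end \<beta> 1 l \<notin> early_states \<beta> J}. z ^ length l)"
      unfolding \<Sigma>_def by (subst sum.union_disjoint[symmetric]) (auto intro!: sum.cong)
    also have "\<dots> \<le> B + K * (1 + \<Sigma> / (1 - z))"
      using bounded[of M] late_return_sum_le[OF beta z01, of c b M J]
      unfolding \<Lambda>_def \<Sigma>_def K_def by (intro add_mono)
    also have "\<dots> = B + K + (K / (1 - z)) * \<Sigma>" by (simp add: algebra_simps)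
    also have "\<dots> \<le> B + K + 1/2 * \<Sigma>"
      using \<open>K / (1 - z) \<le> 1/2\<close> z01 by (intro add_left_mono mult_right_mono) (auto simp: \<Sigma>_def intro!: sum_nonneg)
    finally show "(\<Sum>l\<in>survivor_lyndon_words \<beta> c b M. z ^ length l) \<le> 2 * (B + K)"
      by (simp add: \<Sigma>_def \<Lambda>_def)
  qed
  then show ?thesis by (intro exI[of _ J]) (meson not_le)
qed

text \<open>Otherwise the sums would be dominated by geometric series. The two additional words pay for the one that is discarded at
  the left end \<open>c\<close> and for the smallest one, which only serves as first block of the Cantor set.\<close>

lemma many_early_lyndon_words:
  fixes c b :: real and J n\<^sub>0 :: nat
  assumes "0 < s'" "s' < s"
    and unbounded: "\<And>B. \<exists>M. B < (\<Sum>l\<in>{l\<in>survivor_lyndon_words \<beta> c b M. range_end \<beta> 1 l \<in> early_states \<beta> J}.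
      (\<beta> powr (-s)) ^ length l)"
  shows "\<exists>n\<ge>n\<^sub>0. \<beta> powr (s' * real n) + 2 \<le>
    real (card {l\<in>survivor_lyndon_words \<beta> c b n. length l = n \<and> range_end \<beta> 1 l \<in> early_states \<beta> J})"
proof (rule ccontr)
  define F where "F = (\<lambda>n. {l\<in>survivor_lyndon_words \<beta> c b n. length l = n \<and> range_end \<beta> 1 l \<in> early_states \<beta> J})"
  define z where "z = \<beta> powr (-s)"
  define q where "q = \<beta> powr (s' - s)"
  have z01: "0 < z" "z < 1" using beta assms(1,2) by (auto simp: z_def powr_less_one)
  have q01: "0 < q" "q < 1" using beta assms(1,2) by (auto simp: q_def powr_less_one)
  assume "\<not> ?thesis"
  then have few: "real (card (F n)) \<le> \<beta> powr (s' * real n) + 2" if "n \<ge> n\<^sub>0" for n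
    using that unfolding F_def by (meson not_le less_imp_le)
  have "summable (\<lambda>n. real (card (F n)) * z ^ n)"
  proof (rule summable_comparison_test')
    show "summable (\<lambda>n. q ^ n + 2 * z ^ n)"
      using z01 q01 by (intro summable_add summable_mult summable_geometric) auto
    fix n assume "n \<ge> n\<^sub>0"
    have "\<beta> powr (s' * real n) * z ^ n = \<beta> powr (s' * real n) * \<beta> powr (- s * real n)"
      unfolding z_def using beta by (simp add: powr_powr flip: powr_realpow)
    also have "\<dots> = \<beta> powr ((s' - s) * real n)"
      by (simp add: algebra_simps flip: powr_add)
    also have "\<dots> = q ^ n"
      unfolding q_def using beta by (simp add: powr_powr flip: powr_realpow)
    finally have "\<beta> powr (s' * real n) * z ^ n = q ^ n" .
    moreover have "real (card (F n)) * z ^ n \<le> (\<beta> powr (s' * real n) + 2) * z ^ n"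
      using few[OF \<open>n \<ge> n\<^sub>0\<close>] z01 by (intro mult_right_mono) auto
    ultimately show "norm (real (card (F n)) * z ^ n) \<le> q ^ n + 2 * z ^ n"
      using z01 by (simp add: distrib_right)
  qed
  then have partial: "(\<Sum>n\<le>M. real (card (F n)) * z ^ n) \<le> (\<Sum>n. real (card (F n)) * z ^ n)" for M
    using z01 by (intro sum_le_suminf) auto
  obtain M where M: "(\<Sum>n. real (card (F n)) * z ^ n) <
      (\<Sum>l\<in>{l\<in>survivor_lyndon_words \<beta> c b M. range_end \<beta> 1 l \<in> early_states \<beta> J}. z ^ length l)"
    using unbounded unfolding z_def by blast
  define G where "G = {l\<in>survivor_lyndon_words \<beta> c b M. range_end \<beta> 1 l \<in> early_states \<beta> J}"
  have G: "finite G" "length ` G \<subseteq> {..M}"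
    using finite_survivor_lyndon_words[OF beta, of c b M]
    unfolding G_def by (simp, auto simp: survivor_lyndon_words_def)
  have FG: "{l\<in>G. length l = n} = F n" if "n \<le> M" for n
    using that by (auto simp: F_def G_def survivor_lyndon_words_def)
  have "(\<Sum>l\<in>G. z ^ length l) = (\<Sum>n\<le>M. \<Sum>l\<in>{l\<in>G. length l = n}. z ^ length l)"
    using G by (intro sum.group[symmetric]) auto
  also have "\<dots> = (\<Sum>n\<le>M. real (card (F n)) * z ^ n)"
  proof (intro sum.cong refl)
    fix n assume "n \<in> {..M}"
    then have "{l\<in>G. length l = n} = F n" using FG by simp
    then show "(\<Sum>l\<in>{l\<in>G. length l = n}. z ^ length l) = real (card (F n)) * z ^ n"
      by (simp add: F_def)
  qed
  finally show False using M partial[of M] by (simp add: G_def)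
qed

text \<open>Among \<open>t\<close> and the elements of \<open>R\<close> above it choose the largest \<open>c\<close> whose survivor set is not null, and \<open>e\<close> as the next element
  of \<open>R\<close>, or \<open>1\<close>. The survivor set of \<open>e\<close> is null, so almost every orbit in that of \<open>c\<close> visits \<open>[c, e)\<close>. As
  null sets have null preimages, the part in \<open>[c, e)\<close> cannot be null; it is a countable union of parts below
  numbers \<open>b < e\<close>.\<close>

lemma localise_between_states:
  assumes "finite R" "0 < s" "t < 1" and nonnull: "hausdorff_measure s (survivor_set \<beta> t) \<noteq> 0"
  shows "\<exists>c b e. t \<le> c \<and> c < 1 \<and> b < e \<and> e \<le> 1 \<and> (\<forall>r\<in>R. c < r \<longrightarrow> e \<le> r) \<and>
    hausdorff_measure s (survivor_set \<beta> c \<inter> {..<b}) \<noteq> 0"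
proof -
  define Q where "Q = {c \<in> insert t R. t \<le> c \<and> hausdorff_measure s (survivor_set \<beta> c) \<noteq> 0}"
  define c where "c = Max Q"
  have Q: "finite Q" "t \<in> Q" using assms by (auto simp: Q_def)
  then have "c \<in> Q" unfolding c_def by (intro Max_in) auto
  then have c: "t \<le> c" "hausdorff_measure s (survivor_set \<beta> c) \<noteq> 0" by (auto simp: Q_def)
  have c_max: "x \<le> c" if "x \<in> Q" for x using Q(1) that by (simp add: c_def)
  have empty: "survivor_set \<beta> x = {}" if "1 \<le> x" for x
    using that survivor_set_bounds[of _ \<beta> x] by fastforce
  have "c < 1"
    using c(2) empty[of c] hausdorff_null_empty[of s] by (metis not_le)
  define R' where "R' = insert 1 {r\<in>R. c < r}"
  define e where "e = Min R'"
  have "finite R'" "R' \<noteq> {}" using assms(1) by (auto simp: R'_def)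
  then have "e \<in> R'" and e_min: "\<And>r. r \<in> R' \<Longrightarrow> e \<le> r" unfolding e_def by (auto intro: Min_in)
  then have "c < e" "e \<le> 1" and e_le: "\<forall>r\<in>R. c < r \<longrightarrow> e \<le> r"
    using \<open>c < 1\<close> by (auto simp: R'_def)
  have "hausdorff_measure s (survivor_set \<beta> e) = 0"
  proof (cases "e \<in> R")
    case True
    have "e \<notin> Q" using c_max[of e] \<open>c < e\<close> by auto
    then show ?thesis using True c(1) \<open>c < e\<close> by (auto simp: Q_def)
  next
    case False
    then show ?thesis using \<open>e \<in> R'\<close> empty[of e] hausdorff_null_empty[of s] by (auto simp: R'_def)
  qed
  have "\<exists>i. hausdorff_measure s (survivor_set \<beta> c \<inter> {..<e - 1 / real (Suc i)}) \<noteq> 0"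
  proof (rule ccontr)
    assume "\<nexists>i. hausdorff_measure s (survivor_set \<beta> c \<inter> {..<e - 1 / real (Suc i)}) \<noteq> 0"
    then have "hausdorff_measure s (\<Union>i. survivor_set \<beta> c \<inter> {..<e - 1 / real (Suc i)}) = 0"
      by (intro hausdorff_null_UN) auto
    moreover have "survivor_set \<beta> c \<inter> {..<e} \<subseteq> (\<Union>i. survivor_set \<beta> c \<inter> {..<e - 1 / real (Suc i)})"
    proof
      fix x assume x: "x \<in> survivor_set \<beta> c \<inter> {..<e}"
      then obtain i where "inverse (real (Suc i)) < e - x" using reals_Archimedean[of "e - x"] by auto
      then have "x < e - 1 / real (Suc i)" by (simp add: inverse_eq_divide)
      then show "x \<in> (\<Union>i. survivor_set \<beta> c \<inter> {..<e - 1 / real (Suc i)})" using x by blast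
    qed
    ultimately have null: "hausdorff_measure s (survivor_set \<beta> c \<inter> {..<e}) = 0"
      by (rule hausdorff_null_subset)
    have "hausdorff_measure s (\<Union>k. {x \<in> {0..<1}. (beta_map \<beta> ^^ k) x \<in> survivor_set \<beta> c \<inter> {..<e}}) = 0"
      by (intro hausdorff_null_UN hausdorff_null_preimage[OF beta null \<open>0 < s\<close>])
    then have "hausdorff_measure s (\<Union>i::nat. if i = 0 then survivor_set \<beta> e else
        (\<Union>k. {x \<in> {0..<1}. (beta_map \<beta> ^^ k) x \<in> survivor_set \<beta> c \<inter> {..<e}})) = 0"
      using \<open>hausdorff_measure s (survivor_set \<beta> e) = 0\<close> by (intro hausdorff_null_UN) auto
    moreover have "survivor_set \<beta> c \<subseteq> (\<Union>i::nat. if i = 0 then survivor_set \<beta> e else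
        (\<Union>k. {x \<in> {0..<1}. (beta_map \<beta> ^^ k) x \<in> survivor_set \<beta> c \<inter> {..<e}}))"
    proof
      fix x assume x: "x \<in> survivor_set \<beta> c"
      show "x \<in> (\<Union>i::nat. if i = 0 then survivor_set \<beta> e else
        (\<Union>k. {x \<in> {0..<1}. (beta_map \<beta> ^^ k) x \<in> survivor_set \<beta> c \<inter> {..<e}}))"
      proof (cases "x \<in> survivor_set \<beta> e")
        case True
        then show ?thesis by (intro UN_I[of 0]) auto
      next
        case False
        then obtain k where "(beta_map \<beta> ^^ k) x < e"
          using survivor_set_bounds(1)[OF x] by (auto simp: survivor_set_def not_le)
        then show ?thesis
          using survivor_set_bounds(1)[OF x] survivor_set_funpow[OF beta x, of k]
          by (intro UN_I[of 1]) auto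
      qed
    qed
    ultimately show False using c(2) hausdorff_null_subset by blast
  qed
  then obtain i where "hausdorff_measure s (survivor_set \<beta> c \<inter> {..<e - 1 / real (Suc i)}) \<noteq> 0" ..
  then show ?thesis
    using c(1) \<open>c < 1\<close> \<open>e \<le> 1\<close> e_le
    by (intro exI[of _ c] exI[of _ "e - 1 / real (Suc i)"] exI[of _ e]) auto
qed

section \<open>Cantor sets in the bifurcation set\<close>

text \<open>The Cantor set consists of the points with itinerary \<open>l\<^sub>0 l\<^sub>1 l\<^sub>2 \<dots>\<close>, where \<open>l\<^sub>0\<close> is the smallest word of \<open>F\<close> and
  the others are arbitrary in the rest of \<open>F\<close>. They are indexed by the \<open>N\<close>-ary digits of a number \<open>u\<close>, which
  are its digits under the map \<open>beta_map (real N)\<close>. The inequalities between \<open>e\<close> and the words of \<open>F\<close> ensure that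
  every word may follow every other: the point coded by any sequence of blocks is at most \<open>e\<close>, and this is below
  each \<open>range_end\<close>.\<close>

lemma cantor_set_in_bifurcation_set:
  assumes "finite F" "0 < n" "0 < t" "0 < s"
    and F: "\<And>l. l \<in> F \<Longrightarrow> length l = n" "\<And>l. l \<in> F \<Longrightarrow> lyndon l"
      "\<And>l. l \<in> F \<Longrightarrow> t \<le> branch \<beta> l 0" "\<And>l. l \<in> F \<Longrightarrow> branch \<beta> l 0 + 1 / \<beta> ^ n \<le> e"
      "\<And>l. l \<in> F \<Longrightarrow> e < range_end \<beta> 1 l"
    and card: "\<beta> powr (s * real n) + 1 \<le> real (card F)"
  shows "hausdorff_measure s (bifurcation_set \<beta> \<inter> {t..1}) \<noteq> 0"
proof -
  define l\<^sub>0 where "l\<^sub>0 = Min F"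
  define F' where "F' = F - {l\<^sub>0}"
  define N where "N = card F'"
  define q where "q = 1 / \<beta> ^ n"
  have q: "0 < q" "q < 1" using beta \<open>0 < n\<close> by (auto simp: q_def one_less_power)
  have "1 < \<beta> powr (s * real n)" using beta \<open>0 < n\<close> \<open>0 < s\<close> by simp
  then have "F \<noteq> {}" using card by auto
  then have l\<^sub>0: "l\<^sub>0 \<in> F" "\<And>l. l \<in> F' \<Longrightarrow> l\<^sub>0 < l"
    using \<open>finite F\<close> by (auto simp: l\<^sub>0_def F'_def intro: order.not_eq_order_implies_strict[OF _ Min_le])
  have N: "\<beta> powr (s * real n) \<le> real N"
    using card l\<^sub>0(1) \<open>finite F\<close> by (simp add: N_def F'_def of_nat_diff card_gt_0_iff Suc_le_eq)
  then have N1: "1 < real N" using \<open>1 < \<beta> powr (s * real n)\<close> by linarith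
  obtain L where L: "bij_betw L {..<N} F'"
    using \<open>finite F\<close> unfolding N_def F'_def by (metis bij_betw_from_nat_into_finite finite_Diff)
  define T where "T = beta_map (real N)"
  define dig where "dig = digit (real N)"
  have T: "T u \<in> {0..<1}" for u
    using beta_map_bounds by (simp add: T_def)
  have T_pow: "(T ^^ k) u \<in> {0..<1}" if "u \<in> {0..<1}" for u k
    unfolding T_def using that by (rule beta_map_funpow_bounds)
  have dig: "L (dig u) \<in> F'" if "u \<in> {0..<1}" for u
  proof -
    have "real N * u < real N" "0 \<le> real N * u" using that N1 by auto
    then have "dig u < N" unfolding dig_def digit_def by linarith
    then show ?thesis using L by (auto simp: bij_betw_def)
  qed
  have F'F: "l \<in> F" if "l \<in> F'" for l using that by (simp add: F'_def)
  have valid: "branch_valid \<beta> l y" if "l \<in> F" "y \<le> e" for l y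
    using that F(5)[of l] by (simp add: branch_valid_iff[OF beta])
  have "e < 1" using valid[OF l\<^sub>0(1), of e] by (auto simp: branch_valid_def dest: spec[of _ "length l\<^sub>0"])
  define a where "a = (\<lambda>u. branch \<beta> (L (dig u)) 0)"
  have a: "t \<le> a u" "a u + q \<le> e" if "u \<in> {0..<1}" for u
    using F(3,4)[OF F'F[OF dig[OF that]]] by (simp_all add: a_def q_def)
  \<comment> \<open>The point coded by the free blocks, as the sum of the contributions of its blocks of length \<open>n\<close>.\<close>
  define Z where "Z = (\<lambda>u. \<Sum>k. a ((T ^^ k) u) * q ^ k)"
  have partial: "(\<Sum>k<m. a ((T ^^ k) u) * q ^ k) \<le> e" if "u \<in> {0..<1}" for u m
    using that
  proof (induction m arbitrary: u)
    case 0
    then show ?case using a[OF 0] \<open>0 < t\<close> q by simp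
  next
    case (Suc m)
    have "(\<Sum>k<Suc m. a ((T ^^ k) u) * q ^ k) = a u + q * (\<Sum>k<m. a ((T ^^ k) (T u)) * q ^ k)"
      by (subst sum.lessThan_Suc_shift) (simp add: funpow_swap1 sum_distrib_left mult_ac)
    also have "\<dots> \<le> a u + q * 1"
      using order_trans[OF Suc.IH[OF T] less_imp_le[OF \<open>e < 1\<close>]] q
      by (intro add_left_mono mult_left_mono) auto
    also have "\<dots> \<le> e" using a(2)[OF Suc.prems] by simp
    finally show ?case .
  qed
  have nonneg: "0 \<le> a ((T ^^ k) u) * q ^ k" if "u \<in> {0..<1}" for u k
    using a(1)[OF T_pow[OF that]] \<open>0 < t\<close> q by (intro mult_nonneg_nonneg) (auto intro: order_trans[of 0 t])
  have summable: "summable (\<lambda>k. a ((T ^^ k) u) * q ^ k)" if "u \<in> {0..<1}" for u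
    by (rule summableI_nonneg_bounded[OF nonneg[OF that] partial[OF that]])
  have Z_le: "Z u \<le> e" if "u \<in> {0..<1}" for u
    unfolding Z_def by (rule suminf_le_const[OF summable[OF that] partial[OF that]])
  have Z_rec: "Z u = a u + q * Z (T u)" if "u \<in> {0..<1}" for u
  proof -
    have "(\<Sum>k. a ((T ^^ Suc k) u) * q ^ Suc k) = Z u - a u"
      using suminf_split_head[OF summable[OF that]] by (simp add: Z_def)
    moreover have "(\<Sum>k. a ((T ^^ Suc k) u) * q ^ Suc k) = (\<Sum>k. q * (a ((T ^^ k) (T u)) * q ^ k))"
      by (simp add: funpow_swap1 mult_ac)
    moreover have "\<dots> = q * Z (T u)"
      unfolding Z_def by (rule suminf_mult[OF summable[OF T]])
    ultimately show ?thesis by simp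
  qed
  have Z_ge: "t \<le> Z u" if "u \<in> {0..<1}" for u
  proof -
    have "0 \<le> Z (T u)" unfolding Z_def by (rule suminf_nonneg[OF summable[OF T] nonneg[OF T]])
    then show ?thesis using Z_rec[OF that] a(1)[OF that] q by (simp add: add_increasing2)
  qed
  have Z_branch: "Z u = branch \<beta> (L (dig u)) (Z (T u))" if "u \<in> {0..<1}" for u
    using Z_rec[OF that] branch_affine[OF beta, of "L (dig u)" "Z (T u)"] F(1)[OF F'F[OF dig[OF that]]]
    by (simp add: a_def q_def)
  define h where "h = (\<lambda>u. branch \<beta> l\<^sub>0 (Z u))"
  have step: "beta_map \<beta> (branch \<beta> (drop j l) (Z v)) = branch \<beta> (drop (Suc j) l) (Z v)"
    if "l \<in> F" "j < n" "v \<in> {0..<1}" for l j v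
  proof -
    have "branch_valid \<beta> (drop j l) (Z v)"
      using valid[OF that(1) Z_le[OF that(3)]] by (rule branch_valid_drop[OF beta])
    moreover have "drop j l = l ! j # drop (Suc j) l"
      using that F(1) by (intro Cons_nth_drop_Suc[symmetric]) simp
    ultimately show ?thesis
      using beta_map_branch[OF beta, of "Z v" "l ! j" "drop (Suc j) l"] Z_ge[OF that(3)] \<open>0 < t\<close> by simp
  qed
  have h_in: "h u \<in> bifurcation_set \<beta> \<inter> {t..1}" if u: "u \<in> {0..<1}" for u
  proof -
    \<comment> \<open>The possible orbit points apart from \<open>h u\<close> itself; the word \<open>l\<^sub>0\<close> is excluded at block boundaries.\<close>
    define Orb where "Orb = {branch \<beta> (drop j l) (Z v) | j l v. l \<in> F \<and> j < n \<and> v \<in> {0..<1} \<and> (j = 0 \<longrightarrow> l \<in> F')}"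
    have Orb_step: "beta_map \<beta> (branch \<beta> (drop j l) (Z v)) \<in> Orb" if l: "l \<in> F" "j < n" "v \<in> {0..<1}" for j l v
    proof (cases "Suc j = n")
      case True
      then have "beta_map \<beta> (branch \<beta> (drop j l) (Z v)) = branch \<beta> (drop 0 (L (dig v))) (Z (T v))"
        using step[OF l] Z_branch[OF l(3)] F(1)[OF l(1)] by simp
      then show ?thesis
        using dig[OF l(3)] F'F[OF dig[OF l(3)]] T[of v] \<open>0 < n\<close> unfolding Orb_def by blast
    next
      case False
      then have "Suc j < n" using l by simp
      then show ?thesis using step[OF l] l unfolding Orb_def by blast
    qed
    have orbit: "(beta_map \<beta> ^^ k) (h u) = h u \<or> (beta_map \<beta> ^^ k) (h u) \<in> Orb" for k
    proof (induction k)
      case (Suc k)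
      have "beta_map \<beta> (h u) \<in> Orb" using Orb_step[OF l\<^sub>0(1) \<open>0 < n\<close> u] by (simp add: h_def)
      moreover have "beta_map \<beta> y \<in> Orb" if "y \<in> Orb" for y using that Orb_step unfolding Orb_def by blast
      ultimately show ?case using Suc.IH by auto
    qed simp
    have Orb_gt: "h u < y" if y_Orb: "y \<in> Orb" for y
    proof -
      obtain j l v where y: "y = branch \<beta> (drop j l) (Z v)" "l \<in> F" "j < n" "v \<in> {0..<1}" "j = 0 \<longrightarrow> l \<in> F'"
        using y_Orb unfolding Orb_def by blast
      have "take (n - j) l\<^sub>0 < drop j l"
      proof (cases "j = 0")
        case True
        then show ?thesis using y(5) l\<^sub>0(2) F(1)[OF l\<^sub>0(1)] by simp
      next
        case False
        have "l\<^sub>0 \<le> l" using y(2) \<open>finite F\<close> by (simp add: l\<^sub>0_def)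
        then have "take (n - j) l\<^sub>0 \<le> take (n - j) l"
          using F(1)[OF l\<^sub>0(1)] F(1)[OF y(2)] by (intro take_mono_lex) auto
        also have "\<dots> < drop j l"
          using F(2)[OF y(2)] F(1)[OF y(2)] False y(3) by (auto simp: lyndon_def)
        finally show ?thesis .
      qed
      then have "branch \<beta> (take (n - j) l\<^sub>0) (branch \<beta> (drop (n - j) l\<^sub>0) (Z u)) < branch \<beta> (drop j l) (Z v)"
        using F(1)[OF l\<^sub>0(1)] F(1)[OF y(2)] y(3) Z_ge[OF y(4)] \<open>0 < t\<close>
          branch_valid_take[OF beta valid[OF l\<^sub>0(1) Z_le[OF u]]]
        by (intro branch_less_if_lex_less[OF beta]) auto
      then show ?thesis
        unfolding y(1) h_def by (simp flip: branch_append)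
    qed
    have "t \<le> h u"
      using F(3)[OF l\<^sub>0(1)] branch_mono[OF beta, of 0 "Z u" l\<^sub>0] Z_ge[OF u] \<open>0 < t\<close> by (simp add: h_def)
    moreover have "h u < 1"
      using valid[OF l\<^sub>0(1) Z_le[OF u]] by (auto simp: branch_valid_def h_def dest: spec[of _ 0])
    moreover have "h u \<le> (beta_map \<beta> ^^ k) (h u)" for k
      using orbit[of k] Orb_gt by fastforce
    ultimately show ?thesis using \<open>0 < t\<close> by (auto simp: bifurcation_set_iff[OF beta])
  qed
  \<comment> \<open>Cylinders of different blocks may be adjacent. The gap comes from \<open>t > 0\<close>: no coded point is closer than \<open>q * t\<close> to
    the left end of its cylinder.\<close>
  have separated: "q * t \<le> Z v - Z u"
    if "u \<in> {0..<1}" "v \<in> {0..<1}" "L (dig u) < L (dig v)" for u v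
  proof -
    have "Z u = branch \<beta> (L (dig u)) (Z (T u))" by (rule Z_branch[OF that(1)])
    also have "\<dots> < a v"
      unfolding a_def using that F(1)[OF F'F[OF dig]]
      by (intro branch_less_if_lex_less[OF beta] valid F'F[OF dig] Z_le T) auto
    finally have "Z u < a v" .
    moreover have "q * t \<le> q * Z (T v)" using Z_ge[OF T] q by simp
    ultimately show ?thesis using Z_rec[OF that(2)] by linarith
  qed
  \<comment> \<open>Numbers at distance more than \<open>(1 / N) ^ k\<close> differ in one of their first \<open>k\<close> digits. Up to the first
    difference the inverse branches applied to both are the same; at the difference there is the gap.\<close>
  have expand: "q ^ k * t \<le> \<bar>Z u - Z v\<bar>"
    if "u \<in> {0..<1}" "v \<in> {0..<1}" "(1 / real N) ^ k < \<bar>u - v\<bar>" for u v k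
    using that
  proof (induction k arbitrary: u v)
    case 0
    then show ?case by auto
  next
    case (Suc k)
    show ?case
    proof (cases "dig u = dig v")
      case True
      have "real N * u - real N * v = T u - T v"
        using digit_beta_map[OF N1, of u] digit_beta_map[OF N1, of v] Suc.prems True
        by (simp add: T_def dig_def)
      then have "\<bar>T u - T v\<bar> = real N * \<bar>u - v\<bar>"
        using N1 by (metis abs_mult abs_of_nat right_diff_distrib)
      moreover have "(1 / real N) ^ k < real N * \<bar>u - v\<bar>"
        using Suc.prems(3) N1 by (simp add: field_simps)
      ultimately have "q ^ k * t \<le> \<bar>Z (T u) - Z (T v)\<bar>"
        using Suc.IH[OF T T] by simp
      moreover have "Z u - Z v = q * (Z (T u) - Z (T v))"
        using Z_rec[OF Suc.prems(1)] Z_rec[OF Suc.prems(2)] True by (simp add: a_def algebra_simps)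
      ultimately show ?thesis
        using q by (simp add: abs_mult mult.assoc)
    next
      case False
      have "dig w < N" if "w \<in> {0..<1}" for w
      proof -
        have "real N * w < real N" "0 \<le> real N * w" using that N1 by auto
        then show ?thesis unfolding dig_def digit_def by linarith
      qed
      then have "L (dig u) \<noteq> L (dig v)"
        using False L Suc.prems by (auto simp: bij_betw_def dest: inj_onD)
      then have "q * t \<le> \<bar>Z u - Z v\<bar>"
        using separated[of u v] separated[of v u] Suc.prems(1,2) by (cases "L (dig u) < L (dig v)") force+
      moreover have "q ^ Suc k * t \<le> q * t"
        using q \<open>0 < t\<close> by (intro mult_right_mono) (auto simp: mult_left_le power_le_one)
      ultimately show ?thesis by linarith
    qed
  qed
  define C where "C = real N * (1 / (q * t)) powr s"
  show ?thesis
  proof (rule not_null_if_expanding[where h = h and C = C])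
    show "0 < C" using N1 q \<open>0 < t\<close> by (simp add: C_def)
    show "h ` {0..<1} \<subseteq> bifurcation_set \<beta> \<inter> {t..1}" using h_in by blast
    fix u v :: real assume uv: "u \<in> {0..<1}" "v \<in> {0..<1}"
    show "\<bar>u - v\<bar> \<le> C * dist (h u) (h v) powr s"
    proof (cases "u = v")
      case False
      define k where "k = (LEAST k. (1 / real N) ^ k < \<bar>u - v\<bar>)"
      have "\<exists>k. (1 / real N) ^ k < \<bar>u - v\<bar>"
        using real_arch_pow_inv[of "\<bar>u - v\<bar>" "1 / real N"] False N1 by auto
      then have k: "(1 / real N) ^ k < \<bar>u - v\<bar>" unfolding k_def by (rule LeastI_ex)
      have "k \<noteq> 0" using k uv by (intro notI) auto
      then have "\<not> (1 / real N) ^ (k - 1) < \<bar>u - v\<bar>"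
        unfolding k_def by (intro not_less_Least) (simp add: k_def[symmetric])
      moreover have "(1 / real N) ^ (k - 1) = real N * (1 / real N) ^ k"
        using \<open>k \<noteq> 0\<close> N1 by (cases k) auto
      ultimately have "\<bar>u - v\<bar> \<le> real N * (1 / real N) ^ k" by simp
      also have "(1 / real N) ^ k \<le> (q powr s) ^ k"
      proof (rule power_mono)
        have "q powr s = 1 / \<beta> powr (s * real n)"
          using beta by (simp add: q_def powr_divide powr_powr mult.commute flip: powr_realpow)
        then show "1 / real N \<le> q powr s"
          using N beta frac_le[of 1 1 "\<beta> powr (s * real n)" "real N"] by simp
      qed simp
      also have "(q powr s) ^ k = (q ^ k) powr s"
        using q by (simp add: powr_powr mult.commute flip: powr_realpow)
      also have "\<dots> \<le> (dist (h u) (h v) / (q * t)) powr s"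
      proof (rule powr_mono2)
        have "h u - h v = q * (Z u - Z v)"
          using branch_affine[OF beta, of l\<^sub>0 "Z u"] branch_affine[OF beta, of l\<^sub>0 "Z v"] F(1)[OF l\<^sub>0(1)]
          by (simp add: h_def q_def diff_divide_distrib)
        then have "dist (h u) (h v) = q * \<bar>Z u - Z v\<bar>" using q by (simp add: dist_real_def abs_mult)
        then show "q ^ k \<le> dist (h u) (h v) / (q * t)"
          using expand[OF uv k] q \<open>0 < t\<close> by (simp add: field_simps)
      qed (use q \<open>0 < s\<close> in auto)
      also have "\<dots> = (1 / (q * t)) powr s * dist (h u) (h v) powr s"
        using q \<open>0 < t\<close> by (simp add: powr_divide)
      finally show ?thesis using N1 by (simp add: C_def mult_left_mono mult.assoc)
    qed (simp add: C_def)
  qed fact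
qed

text \<open>A word of the family that begins to the left of \<open>c\<close> has a cylinder containing points not to the left of \<open>c\<close>; as
  cylinders of one order are disjoint there is at most one such word. It is discarded so that all the blocks lie in
  \<open>[t, 1)\<close>.\<close>

lemma bifurcation_set_not_null:
  assumes "0 < t" "t < 1" "0 < s'" "s' < s" "hausdorff_measure s (survivor_set \<beta> t) \<noteq> 0"
  shows "hausdorff_measure s' (bifurcation_set \<beta> \<inter> {t..1}) \<noteq> 0"
proof -
  have "0 < s" using assms by simp
  obtain J where J: "\<And>c b B. hausdorff_measure s (survivor_set \<beta> c \<inter> {..<b}) \<noteq> 0 \<Longrightarrow>
    \<exists>M. B < (\<Sum>l\<in>{l\<in>survivor_lyndon_words \<beta> c b M. range_end \<beta> 1 l \<in> early_states \<beta> J}. (\<beta> powr (-s)) ^ length l)"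
    using early_lyndon_sums_unbounded[OF \<open>0 < s\<close> refl] by blast
  have "finite (early_states \<beta> J)" by (simp add: early_states_def)
  from localise_between_states[OF this \<open>0 < s\<close> assms(2,5)]
  obtain c b e where cbe: "t \<le> c" "b < e" "e \<le> 1" "\<forall>r\<in>early_states \<beta> J. c < r \<longrightarrow> e \<le> r"
    "hausdorff_measure s (survivor_set \<beta> c \<inter> {..<b}) \<noteq> 0" by blast
  obtain n\<^sub>0 where n\<^sub>0: "(1 / \<beta>) ^ n\<^sub>0 < (e - b) / 2"
    using real_arch_pow_inv[of "(e - b) / 2" "1 / \<beta>"] cbe(2) beta by auto
  obtain n where n: "n \<ge> Suc n\<^sub>0" "\<beta> powr (s' * real n) + 2 \<le>
    real (card {l\<in>survivor_lyndon_words \<beta> c b n. length l = n \<and> range_end \<beta> 1 l \<in> early_states \<beta> J})"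
    using many_early_lyndon_words[OF assms(3,4) J[OF cbe(5)], of "Suc n\<^sub>0"] by blast
  define G where "G = {l\<in>survivor_lyndon_words \<beta> c b n. length l = n \<and> range_end \<beta> 1 l \<in> early_states \<beta> J}"
  define F where "F = {l\<in>G. c \<le> branch \<beta> l 0}"
  have "finite G"
    using finite_survivor_lyndon_words[OF beta, of c b n] by (simp add: G_def)
  have not_less: "\<not> l < l'" if l: "l \<in> G" "l' \<in> G - F" for l l'
  proof
    assume "l < l'"
    obtain x where x: "x \<in> survivor_set \<beta> c" "itinerary \<beta> n x = l"
      using l(1) by (auto simp: G_def survivor_lyndon_words_def)
    have x01: "x \<in> {0..<1}" by (rule survivor_set_bounds(1)[OF x(1)])
    have "branch \<beta> l ((beta_map \<beta> ^^ n) x) < branch \<beta> l' 0"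
      using \<open>l < l'\<close> l branch_valid_itinerary[OF beta x01, of n] x(2)
      by (intro branch_less_if_lex_less[OF beta]) (auto simp: G_def)
    then have "x < branch \<beta> l' 0" using branch_itinerary[OF beta x01, of n] x(2) by simp
    then show False using survivor_set_bounds(2)[OF x(1)] l(2) by (auto simp: F_def)
  qed
  have "card (G - F) \<le> 1"
  proof (rule card_le_Suc0_iff_eq[THEN iffD2, unfolded One_nat_def[symmetric]])
    show "\<forall>x\<in>G - F. \<forall>y\<in>G - F. x = y" using not_less by (metis Diff_iff linorder_neqE)
  qed (use \<open>finite G\<close> in auto)
  moreover have "card G = card F + card (G - F)"
    using \<open>finite G\<close> by (subst card_Un_disjoint[symmetric]) (auto simp: F_def intro: arg_cong[of _ _ card])
  ultimately have card: "\<beta> powr (s' * real n) + 1 \<le> real (card F)"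
    using n(2) unfolding G_def[symmetric] by linarith
  show ?thesis
  proof (rule cantor_set_in_bifurcation_set[where F = F and n = n and e = "(e + b) / 2"])
    fix l assume l: "l \<in> F"
    then have l': "l \<in> survivor_lyndon_words \<beta> c b n" "length l = n" "range_end \<beta> 1 l \<in> early_states \<beta> J"
      by (auto simp: F_def G_def)
    show "length l = n" "lyndon l" "t \<le> branch \<beta> l 0"
      using l l' cbe(1) by (auto simp: F_def survivor_lyndon_words_def)
    have "1 / \<beta> ^ n \<le> (1 / \<beta>) ^ n\<^sub>0"
      using n(1) beta by (simp add: power_one_over frac_le power_increasing)
    moreover have "branch \<beta> l 0 < b" using l'(1) by (simp add: survivor_lyndon_words_def)
    ultimately show "branch \<beta> l 0 + 1 / \<beta> ^ n \<le> (e + b) / 2" using n\<^sub>0 by (simp add: field_simps)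
    have "e \<le> range_end \<beta> 1 l"
      using cbe(4) l'(3) survivor_lyndon_word_range_end(1)[OF beta l'(1)] by blast
    then show "(e + b) / 2 < range_end \<beta> 1 l" using cbe(2) by simp
  qed (use \<open>finite G\<close> n(1) assms card in \<open>auto simp: F_def\<close>)
qed

end

section \<open>Equality of the dimensions\<close>

theorem theorem1p1:
  fixes \<beta> t :: real
  assumes "\<beta> > 1" and "t \<in> {0<..<1}"
  shows "hausdorff_dim (bifurcation_set \<beta> \<inter> {t..1}) = hausdorff_dim (survivor_set \<beta> t)"
proof (rule antisym)
  show "hausdorff_dim (bifurcation_set \<beta> \<inter> {t..1}) \<le> hausdorff_dim (survivor_set \<beta> t)"
    using assms(1) by (intro hausdorff_dim_mono bifurcation_subset_survivor)
  show "hausdorff_dim (survivor_set \<beta> t) \<le> hausdorff_dim (bifurcation_set \<beta> \<inter> {t..1})"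
  proof (rule ccontr)
    assume "\<not> ?thesis"
    then have "hausdorff_dim (bifurcation_set \<beta> \<inter> {t..1}) < hausdorff_dim (survivor_set \<beta> t)"
      by simp
    then obtain x where x: "hausdorff_dim (bifurcation_set \<beta> \<inter> {t..1}) < x" "x < hausdorff_dim (survivor_set \<beta> t)"
      using dense by blast
    obtain y where y: "x < y" "y < hausdorff_dim (survivor_set \<beta> t)" using dense[OF x(2)] by blast
    obtain s' where s': "x = ennreal s'" "0 \<le> s'"
      using y(1) by (cases x) auto
    obtain s where s: "y = ennreal s" "0 \<le> s"
      using y(2) by (cases y) auto
    have "0 < s'" using x(1) s' by (cases "s' = 0") auto
    have "s' < s" using y(1) s s' by (simp add: ennreal_less_iff)
    have "hausdorff_measure s (survivor_set \<beta> t) \<noteq> 0"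
      using not_null_below_hausdorff_dim[OF s(2)] y(2) s(1) by blast
    then have "hausdorff_measure s' (bifurcation_set \<beta> \<inter> {t..1}) \<noteq> 0"
      using assms \<open>0 < s'\<close> \<open>s' < s\<close> by (intro bifurcation_set_not_null) auto
    then have "x \<le> hausdorff_dim (bifurcation_set \<beta> \<inter> {t..1})"
      using hausdorff_dim_ge s' by blast
    then show False using x(1) by simp
  qed
qed

end
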